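(* Let $D\subsetneq\mathbb{C}^n$ be a proper $\mathbb{C}$-convex domain. Then for all $z,w\in D$, $$c_D(z,w)\ge\frac14\log\frac{d_D(z)}{4d_D(w)}.$$ Hence, if in addition $D$ is bounded, then for any compact subset $K$ of $D$ there is a constant $c_K>0$ such that $$b_D(z,w)\ge-\frac14\log d_D(w)-c_K,\qquad z\in K,\ w\in D.$$
   Context: $\mathbb{D}$ is the open unit disc in $\mathbb{C}$; $\mathcal{O}(X,Y)$ is the set of holomorphic maps $X\to Y$; $d_D(z)=\mathrm{dist}(z,\partial D)$ is the Euclidean distance to the boundary. Proper means $D\ne\mathbb{C}^n$. A set in $\mathbb{C}^n$ is $\mathbb{C}$-convex if all its (nonempty) intersections with complex lines (one-dimensional complex affine subspaces) are contractible. The Carathéodory distance of $D$ is $$c_D(z,w)=\sup\{\tanh^{-1}|f(w)|: f\in\mathcal{O}(D,\mathbb{D})\text{ with } f(z)=0\}.$$ The Bergman distance $b_D$ is $$b_D(z,w)=\inf_\gamma\int_0^1\beta_D(\gamma(t);\gamma'(t))\,dt,$$ where the infimum is over all smooth curves $\gamma:[0,1]\to D$ with $\gamma(0)=z$, $\gamma(1)=w$. Here $\beta_D(z;X)=M_D(z;X)/\sqrt{K_D(z)}$ is the Bergman metric, with $M_D(z;X)=\sup\{|f'(z)X|: f\in L^2_h(D),\ \|f\|_D=1,\ f(z)=0\}$ and $K_D(z)=\sup\{|f(z)|^2: f\in L^2_h(D),\ \|f\|_D\le 1\}$, where $L^2_h(D)$ is the space of square-integrable holomorphic functions on $D$ with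 its $L^2$ norm $\|\cdot\|_D$. *)

theory Defs
  imports "HOL-Analysis.Analysis"
begin

(* Holomorphy of several variables on an open set: complex differentiability, i.e. real Frechet
   differentiability with a complex-linear derivative.  The library constant holomorphic_on only
   covers functions of one variable. *)
definition holo_on :: "(complex^'n \<Rightarrow> complex) \<Rightarrow> (complex^'n) set \<Rightarrow> bool"
    (infix \<open>holo'_on\<close> 50) where
  "f holo_on D \<longleftrightarrow>
     (\<forall>z\<in>D. \<exists>f'. (f has_derivative f') (at z) \<and> (\<forall>c X. f' (c *s X) = c * f' X))"

definition complex_line :: "(complex^'n) set \<Rightarrow> bool" where
  "complex_line L \<longleftrightarrow> (\<exists>a v. v \<noteq> 0 \<and> L = range (\<lambda>c::complex. a + c *s v))"

definition C_convex :: "(complex^'n) set \<Rightarrow> bool" where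
  "C_convex D \<longleftrightarrow> (\<forall>L. complex_line L \<and> D \<inter> L \<noteq> {} \<longrightarrow> contractible (D \<inter> L))"

definition bdist :: "(complex^'n) set \<Rightarrow> complex^'n \<Rightarrow> real" where
  "bdist D z = infdist z (frontier D)"

definition caratheodory_dist :: "(complex^'n) set \<Rightarrow> complex^'n \<Rightarrow> complex^'n \<Rightarrow> ereal" where
  "caratheodory_dist D z w =
     (SUP f\<in>{f. f holo_on D \<and> f ` D \<subseteq> ball 0 1 \<and> f z = 0}. ereal (artanh (cmod (f w))))"

(* Values outside D are irrelevant to membership in L2h D and to L2_norm D. *)
definition L2h :: "(complex^'n) set \<Rightarrow> (complex^'n \<Rightarrow> complex) set" where
  "L2h D = {f. f holo_on D \<and> set_integrable lborel D (\<lambda>z. (cmod (f z))\<^sup>2)}"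

definition L2_norm :: "(complex^'n) set \<Rightarrow> (complex^'n \<Rightarrow> complex) \<Rightarrow> real" where
  "L2_norm D f = sqrt (LINT z:D|lborel. (cmod (f z))\<^sup>2)"

(* The real suprema in bergman_kernel and bergman_M are the mathematical ones when D is nonempty,
   open and bounded and z lies in D: both sets are then nonempty and bounded above, and the
   kernel is positive. *)
definition bergman_kernel :: "(complex^'n) set \<Rightarrow> complex^'n \<Rightarrow> real" where
  "bergman_kernel D z = (SUP f\<in>{f \<in> L2h D. L2_norm D f \<le> 1}. (cmod (f z))\<^sup>2)"

definition bergman_M :: "(complex^'n) set \<Rightarrow> complex^'n \<Rightarrow> complex^'n \<Rightarrow> real" where
  "bergman_M D z X =
     (SUP f\<in>{f \<in> L2h D. L2_norm D f = 1 \<and> f z = 0}. cmod (frechet_derivative f (at z) X))"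

definition bergman_metric :: "(complex^'n) set \<Rightarrow> complex^'n \<Rightarrow> complex^'n \<Rightarrow> real" where
  "bergman_metric D z X = bergman_M D z X / sqrt (bergman_kernel D z)"

definition velocity :: "(real \<Rightarrow> complex^'n) \<Rightarrow> real \<Rightarrow> complex^'n" where
  "velocity \<gamma> t = vector_derivative \<gamma> (at t within {0..1})"

(* C-infinity on the closed unit interval, with one-sided derivatives at the end points. *)
definition smooth_curve :: "(real \<Rightarrow> complex^'n) \<Rightarrow> bool" where
  "smooth_curve \<gamma> \<longleftrightarrow> (\<forall>k. (velocity ^^ k) \<gamma> differentiable_on {0..1})"

(* The integrand is nonnegative, so its integral is taken as a nonnegative Lebesgue integral,
   which needs no integrability side condition. *)
definition bergman_dist :: "(complex^'n) set \<Rightarrow> complex^'n \<Rightarrow> complex^'n \<Rightarrow> ereal" where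
  "bergman_dist D z w =
     (INF \<gamma>\<in>{\<gamma>. smooth_curve \<gamma> \<and> \<gamma> ` {0..1} \<subseteq> D \<and> \<gamma> 0 = z \<and> \<gamma> 1 = w}.
        enn2ereal (\<integral>\<^sup>+t\<in>{0..1}. ennreal (bergman_metric D (\<gamma> t) (velocity \<gamma> t)) \<partial>lborel))"

end

theory Submission
  imports Defs "HOL-Complex_Analysis.Complex_Analysis"
begin

text \<open>Let p be a boundary point nearest to w. Some complex hyperplane through p misses D: a minimal
  family of linear functionals without common zero in D - p consists of a single functional,
  because two of them would map a section of D into the punctured plane so that every line
  through the origin is hit, and contractibility of the line sections of D would then trivialise
  the tautological bundle of the projective line. The functional l vanishing on the hyperplane maps
  D onto a simply connected planar domain omitting 0: logarithms of l - c exist along complex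
  lines and are constant on the fibres of l. The moduli of l z and l w compare with the boundary
  distances of z and w, so it remains to bound the Riemann map of such a domain. This is the
  Koebe estimate for a nonvanishing univalent g, which follows from an area comparison for
  (h - a) / (h + a), where h is a square root of g and a = h 0; integrating it along a radius
  gives the constant 1/4.

  For bounded D, multiplying f in the Bergman space by F followed by a disc automorphism bounds the
  Bergman metric below by the pull-back of the Poincare metric under F, whence the Bergman
  distance dominates the Caratheodory distance.\<close>

section \<open>Logarithms along complex lines\<close>

text \<open>Contractibility is given line by line, with no uniformity in the line, and the boundary
  need not have a tangent hyperplane. What can be controlled is the increment of a logarithm between
  two points of one line section: it is free of the additive ambiguity of logarithms and depends
  continuously on the two points. Such increments can therefore be compared between different lines,
  glued, and pushed down to quotients.

  The constant 1/4 is that of the slit plane. The map ((1 + z) / (1 - z))^2 sends the disc onto the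
  complement of the nonpositive reals, with value 1 and derivative 4 at 0, and no univalent function
  without zeros has a larger logarithmic derivative at 0. Transported to all points of the disc,
  this says that log |g| is Lipschitz with constant 4 in the hyperbolic metric, in which 0 and z
  have distance artanh |z|.\<close>

lemma norm_smult: "norm (c *s x) = cmod c * norm (x :: complex^'n)"
  by (simp add: norm_vec_def L2_set_def norm_mult power_mult_distrib
      real_sqrt_mult flip: sum_distrib_left)

lemma bounded_bilinear_smult: "bounded_bilinear ((*s) :: complex \<Rightarrow> complex^'n \<Rightarrow> complex^'n)"
  by (rule bounded_bilinear.intro)
     (auto simp: vec_eq_iff algebra_simps norm_smult intro!: exI[of _ 1])

lemmas continuous_on_smult [continuous_intros] =
  bounded_bilinear.continuous_on[OF bounded_bilinear_smult]

text \<open>Two logarithms of one number differ by a multiple of 2 pi i, so the values of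
  \<open>h\<close> are isolated. The comparisons of branches below rest on this.\<close>

lemma continuous_exp_constant:
  fixes h :: "'a::topological_space \<Rightarrow> complex"
  assumes "connected S" "continuous_on S h" "\<And>x. x \<in> S \<Longrightarrow> exp (h x) = c"
    and "x \<in> S" "y \<in> S"
  shows "h x = h y"
proof -
  have "h constant_on S"
  proof (rule continuous_discrete_range_constant[OF assms(1,2)])
    fix x assume x: "x \<in> S"
    show "\<exists>e>0. \<forall>y. y \<in> S \<and> h y \<noteq> h x \<longrightarrow> e \<le> norm (h y - h x)"
    proof (intro exI conjI allI impI)
      show "(0::real) < 2 * pi" by simp
      fix y assume y: "y \<in> S \<and> h y \<noteq> h x"
      then have "exp (h y) = exp (h x)" using assms(3) x by simp
      then obtain n :: int where n: "h y = h x + (of_int (2 * n) * pi) * \<i>"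
        unfolding exp_eq by blast
      with y have "n \<noteq> 0" by auto
      then have "1 \<le> \<bar>real_of_int n\<bar>" by linarith
      moreover have "norm (h y - h x) = 2 * \<bar>real_of_int n\<bar> * pi"
        using n by (simp add: norm_mult)
      ultimately show "2 * pi \<le> norm (h y - h x)" by simp
    qed
  qed
  with assms(4,5) show ?thesis unfolding constant_on_def by metis
qed

text \<open>A branch of log f on a line section is fixed only up to a constant, but its increment
  from \<open>u\<close> to \<open>v\<close> is determined. The increment is continuous in the pair
  because a compact path inside one section stays in \<open>D\<close> when the line is perturbed,
  and along it the ratio of the values of \<open>f\<close> on the two lines stays close to 1. Zeros
  of \<open>f\<close> off the lines given by \<open>W\<close> are allowed.\<close>

lemma linewise_logarithm:
  fixes D :: "(complex^'n) set" and f :: "complex^'n \<Rightarrow> complex"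
  assumes "open D" "continuous_on D f" "W \<subseteq> D \<times> D"
    and contr: "\<And>u v. (u, v) \<in> W \<Longrightarrow> contractible {t. u + t *s (v - u) \<in> D}"
    and nz: "\<And>u v t. (u, v) \<in> W \<Longrightarrow> u + t *s (v - u) \<in> D \<Longrightarrow> f (u + t *s (v - u)) \<noteq> 0"
  obtains \<Lambda> where "continuous_on W \<Lambda>" "\<And>u v. (u, v) \<in> W \<Longrightarrow> exp (\<Lambda> (u, v)) = f v / f u"
proof -
  define L where "L = (\<lambda>p t. fst p + t *s (snd p - fst p) :: complex^'n)"
  define T where "T = (\<lambda>p. {t. L p t \<in> D})"
  have L_cont: "continuous_on S (\<lambda>x. L (a x) (b x))"
    if "continuous_on S a" "continuous_on S b"
    for S :: "'c::topological_space set" and a b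
    unfolding L_def using that by (intro continuous_intros)
  have "\<exists>g. continuous_on (T p) g \<and> (\<forall>t\<in>T p. f (L p t) = exp (g t))" if p: "p \<in> W" for p
  proof -
    have "continuous_on (T p) (\<lambda>t. f (L p t))"
      by (rule continuous_on_compose2[OF assms(2)])
         (auto simp: T_def intro!: L_cont continuous_intros)
    moreover have "contractible (T p)"
      using contr[of "fst p" "snd p"] p by (simp add: T_def L_def)
    moreover have "\<And>t. t \<in> T p \<Longrightarrow> f (L p t) \<noteq> 0"
      using nz[of "fst p" "snd p"] p by (simp add: T_def L_def)
    ultimately show ?thesis using continuous_logarithm_on_contractible by metis
  qed
  then obtain g where g: "\<And>p. p \<in> W \<Longrightarrow> continuous_on (T p) (g p)"
    "\<And>p t. p \<in> W \<Longrightarrow> t \<in> T p \<Longrightarrow> f (L p t) = exp (g p t)"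
    by metis
  define \<Lambda> where "\<Lambda> = (\<lambda>p. g p 1 - g p 0)"
  have L0 [simp]: "L p 0 = fst p" and L1 [simp]: "L p 1 = snd p" for p
    by (simp_all add: L_def)
  have T01: "0 \<in> T p" "1 \<in> T p" if "p \<in> W" for p
    using that assms(3) by (auto simp: T_def mem_Times_iff)
  have expL: "exp (\<Lambda> (u, v)) = f v / f u" if p: "(u, v) \<in> W" for u v
    using g(2)[OF p, of 0] g(2)[OF p, of 1] T01[OF p] by (simp add: \<Lambda>_def exp_diff)
  have "continuous_on W \<Lambda>"
    unfolding continuous_on_eq_continuous_within
  proof
    fix p0 assume p0: "p0 \<in> W"
    have "open (T p0)"
    proof -
      have "T p0 = L p0 -` D" by (auto simp: T_def)
      then show ?thesis
        using open_vimage[OF assms(1), of "L p0"] L_cont[of UNIV "\<lambda>_. p0" "\<lambda>x. x"]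
        by (auto intro: continuous_intros)
    qed
    moreover have "connected (T p0)"
      using contr[of "fst p0" "snd p0"] p0 contractible_imp_connected
      by (simp add: T_def L_def)
    ultimately have "path_connected (T p0)" by (simp add: connected_open_path_connected)
    then obtain \<gamma> where \<gamma>: "path \<gamma>" "path_image \<gamma> \<subseteq> T p0" "\<gamma> 0 = 0" "\<gamma> 1 = 1"
      using T01[OF p0] unfolding path_connected_def pathstart_def pathfinish_def by metis
    have \<gamma>c: "continuous_on {0..1} \<gamma>" using \<gamma>(1) by (simp add: path_def)
    define K where "K = \<gamma> ` {0..1}"
    have K: "compact K" "K \<subseteq> T p0" "connected K"
      using \<gamma>(2) \<gamma>c unfolding K_def path_image_def
      by (simp_all add: compact_continuous_image connected_continuous_image)
    have "0 \<in> K" "1 \<in> K"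
      using \<gamma>(3,4) unfolding K_def by (metis atLeastAtMost_iff imageI order_refl zero_le_one)+
    note K = K this
    define V where "V = (\<lambda>(p, t). L p t) -` D"
    have "open V" unfolding V_def
      by (rule open_vimage[OF assms(1)])
         (auto simp: case_prod_unfold intro!: L_cont continuous_intros)
    moreover have "{p0} \<times> K \<subseteq> V" using K(2) by (auto simp: V_def T_def)
    ultimately obtain X0 where X0: "p0 \<in> X0" "open X0" "X0 \<times> K \<subseteq> V"
      using Elementary_Topology.tube_lemma[OF K(1), of V p0] by auto
    \<comment> \<open>Compares \<open>f\<close> on a nearby line with \<open>f\<close> on the line
      of \<open>p0\<close> at equal parameters. The quotient is 1 at \<open>p0\<close>, so near
      \<open>p0\<close> it avoids the slit of \<open>Ln\<close>, uniformly on the compact set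
      \<open>K\<close>.\<close>
    define \<Phi> where "\<Phi> = (\<lambda>(p, t). f (L p t) / f (L p0 t))"
    have nz0: "f (L p0 t) \<noteq> 0" if "t \<in> K" for t
      using nz[of "fst p0" "snd p0"] p0 that K(2) by (auto simp: T_def L_def)
    have Lin: "L p t \<in> D" if "p \<in> X0" "t \<in> K" for p t
      using that X0(3) by (auto simp: V_def)
    have "continuous_on (X0 \<times> K) \<Phi>"
      unfolding \<Phi>_def case_prod_unfold
      by (intro continuous_intros continuous_on_compose2[OF assms(2)] L_cont)
         (use nz0 Lin Lin[OF X0(1)] in auto)
    then obtain X1 where X1: "p0 \<in> X1" "open X1"
      "\<forall>p\<in>X1 \<inter> X0. \<forall>t\<in>K. dist (\<Phi> (p, t)) (\<Phi> (p0, t)) \<le> 1/2"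
      by (rule continuous_on_prod_compactE[OF _ K(1) X0(1), of \<Phi> "1/2"]) auto
    have \<Phi>slit: "\<Phi> (p, t) \<notin> \<real>\<^sub>\<le>\<^sub>0" if "p \<in> X1 \<inter> X0" "t \<in> K" for p t
    proof -
      have "cmod (\<Phi> (p, t) - 1) \<le> 1/2"
        using bspec[OF bspec[OF X1(3) that(1)] that(2)] nz0[OF that(2)] by (simp add: \<Phi>_def dist_norm)
      then have "Re (\<Phi> (p, t)) \<ge> 1/2"
        using abs_Re_le_cmod[of "\<Phi> (p, t) - 1"] by simp
      then show ?thesis by (auto simp: complex_nonpos_Reals_iff)
    qed
    \<comment> \<open>Along \<open>K\<close> the branch \<open>g p\<close> and the sum of
      \<open>g p0\<close> and \<open>Ln (\<Phi> (p, t))\<close> are logarithms of the same function;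
      their constant difference cancels between the parameters 0 and 1.\<close>
    have key: "\<Lambda> p = \<Lambda> p0 + Ln (\<Phi> (p, 1)) - Ln (\<Phi> (p, 0))" if p: "p \<in> X1 \<inter> X0 \<inter> W" for p
    proof -
      have KT: "K \<subseteq> T p" using Lin[of p] p by (auto simp: T_def)
      define h where "h = (\<lambda>t. g p t - g p0 t - Ln (\<Phi> (p, t)))"
      have "continuous_on K h"
      proof -
        have "continuous_on K (\<lambda>t. \<Phi> (p, t))"
          by (rule continuous_on_compose2[OF \<open>continuous_on (X0 \<times> K) \<Phi>\<close>])
             (use p in \<open>auto intro!: continuous_intros\<close>)
        then show ?thesis unfolding h_def
          by (intro continuous_intros continuous_on_Ln continuous_on_subset[OF g(1) KT]
              continuous_on_subset[OF g(1) K(2)]) (use p p0 \<Phi>slit in auto)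
      qed
      moreover have "exp (h t) = 1" if t: "t \<in> K" for t
      proof -
        have "\<Phi> (p, t) \<noteq> 0" using \<Phi>slit[of p t] p t by fastforce
        then show ?thesis
          using g(2)[of p t] g(2)[of p0 t] subsetD[OF KT t] subsetD[OF K(2) t] p p0 t
          by (auto simp: h_def exp_diff \<Phi>_def)
      qed
      ultimately have "h 0 = h 1"
        using continuous_exp_constant[OF K(3)] K(4,5) by blast
      then show ?thesis by (simp add: h_def \<Lambda>_def algebra_simps)
    qed
    have "continuous (at p0 within W) (\<lambda>p. \<Lambda> p0 + Ln (\<Phi> (p, 1)) - Ln (\<Phi> (p, 0)))"
    proof -
      have "continuous_on (X1 \<inter> X0) (\<lambda>p. \<Lambda> p0 + Ln (\<Phi> (p, 1)) - Ln (\<Phi> (p, 0)))"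
        by (intro continuous_intros continuous_on_Ln
            continuous_on_compose2[OF \<open>continuous_on (X0 \<times> K) \<Phi>\<close>])
           (use \<Phi>slit K in auto)
      moreover have "open (X1 \<inter> X0)" using X1 X0 by auto
      ultimately show ?thesis
        using X1(1) X0(1) continuous_on_eq_continuous_at
        by (metis (no_types, lifting) IntI continuous_at_imp_continuous_at_within)
    qed
    moreover have "eventually (\<lambda>p. \<Lambda> p0 + Ln (\<Phi> (p, 1)) - Ln (\<Phi> (p, 0)) = \<Lambda> p) (at p0 within W)"
      unfolding eventually_at_topological
      by (rule exI[of _ "X1 \<inter> X0"]) (use X1 X0 key in auto)
    moreover have "\<Lambda> p0 + Ln (\<Phi> (p0, 1)) - Ln (\<Phi> (p0, 0)) = \<Lambda> p0"
      using key[of p0] p0 X1(1) X0(1) by auto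
    ultimately show "continuous (at p0 within W) \<Lambda>"
      unfolding continuous_within by (auto intro: Lim_transform_eventually)
  qed
  with expL that show thesis by blast
qed

lemma contractible_line_parameters:
  fixes D :: "(complex^'n) set"
  assumes "C_convex D" "u \<in> D"
  shows "contractible {t. u + t *s (v - u) \<in> D}"
proof (cases "u = v")
  case True
  \<comment> \<open>For a degenerate pair the parameter set is the whole plane, since
    \<open>u\<close> lies in \<open>D\<close>.\<close>
  with assms show ?thesis by (simp add: convex_imp_contractible)
next
  case False
  define L where "L = range (\<lambda>c::complex. u + c *s (v - u))"
  define T where "T = {t. u + t *s (v - u) \<in> D}"
  from False obtain i where i: "(v - u) $ i \<noteq> 0"
    by (metis eq_iff_diff_eq_0 vec_eq_iff zero_index)
  have dv: "(t * v $ i - t * u $ i) / (v $ i - u $ i) = t" for t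
    using i by (simp flip: right_diff_distrib)
  have "complex_line L" using False unfolding complex_line_def L_def
    by (intro exI[of _ u] exI[of _ "v - u"]) simp
  moreover have "u \<in> D \<inter> L" using assms(2) unfolding L_def
    by (auto intro!: image_eqI[of _ _ 0])
  ultimately have "contractible (D \<inter> L)" using assms(1) unfolding C_convex_def by blast
  moreover have "T homeomorphic (D \<inter> L)"
  proof (rule homeomorphicI)
    show "(\<lambda>t. u + t *s (v - u)) ` T = D \<inter> L"
      by (auto simp: T_def L_def)
    show "(\<lambda>x. (x - u) $ i / (v - u) $ i) ` (D \<inter> L) = T"
    proof safe
      fix x assume "x \<in> D" "x \<in> L"
      then show "(x - u) $ i / (v - u) $ i \<in> T" by (auto simp: T_def L_def dv)
    next
      fix t assume "t \<in> T"
      then show "t \<in> (\<lambda>x. (x - u) $ i / (v - u) $ i) ` (D \<inter> L)" using i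
        by (intro image_eqI[of _ _ "u + t *s (v - u)"]) (auto simp: T_def L_def dv)
    qed
    show "continuous_on T (\<lambda>t. u + t *s (v - u))" by (intro continuous_intros)
    show "continuous_on (D \<inter> L) (\<lambda>x. (x - u) $ i / (v - u) $ i)"
      using i by (intro continuous_intros) auto
  qed (auto simp: L_def dv)
  ultimately show ?thesis unfolding T_def using homeomorphic_contractible homeomorphic_sym by blast
qed

text \<open>The condition on \<open>A\<close> describes complex affine subspaces (or the empty set).
  The section of \<open>D\<close> by the line through two points of \<open>D \<inter> A\<close> is
  connected, stays in \<open>A\<close> and contains both points.\<close>

lemma connected_C_convex_Int:
  fixes D :: "(complex^'n) set"
  assumes "C_convex D"
    and A: "\<And>u v t. u \<in> A \<Longrightarrow> v \<in> A \<Longrightarrow> u + t *s (v - u) \<in> A"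
  shows "connected (D \<inter> A)"
  unfolding connected_iff_connected_component
proof (intro ballI)
  fix u v assume uv: "u \<in> D \<inter> A" "v \<in> D \<inter> A"
  define T where "T = {t. u + t *s (v - u) \<in> D}"
  have "connected T"
    unfolding T_def using contractible_line_parameters[OF assms(1)] uv contractible_imp_connected by blast
  then have "connected ((\<lambda>t. u + t *s (v - u)) ` T)"
    by (rule connected_continuous_image[rotated]) (intro continuous_intros)
  moreover have "(\<lambda>t. u + t *s (v - u)) ` T \<subseteq> D \<inter> A"
    using uv A by (auto simp: T_def)
  moreover have "u \<in> (\<lambda>t. u + t *s (v - u)) ` T"
    using uv by (auto simp: T_def intro!: image_eqI[of _ _ 0])
  moreover have "v \<in> (\<lambda>t. u + t *s (v - u)) ` T"
    using uv by (auto simp: T_def intro!: image_eqI[of _ _ 1])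
  ultimately show "connected_component (D \<inter> A) u v"
    unfolding connected_component_def by blast
qed

section \<open>Complex linear functionals and the fibres of maps to the plane\<close>

text \<open>No conjugation is involved: the pairing is linear in both arguments, so that
  \<open>cdot a\<close> is a holomorphic function.\<close>

definition cdot :: "complex^'n \<Rightarrow> complex^'n \<Rightarrow> complex" where
  "cdot a x = (\<Sum>i\<in>UNIV. a $ i * x $ i)"

lemma cdot_add: "cdot a (x + y) = cdot a x + cdot a y"
  and cdot_diff: "cdot a (x - y) = cdot a x - cdot a y"
  and cdot_smult: "cdot a (c *s x) = c * cdot a x"
  and cdot_diff_left: "cdot (a - b) x = cdot a x - cdot b x"
  and cdot_smult_left: "cdot (c *s a) x = c * cdot a x"
  and cdot_zero [simp]: "cdot a 0 = 0"
  by (simp_all add: cdot_def algebra_simps sum.distrib sum_subtractf sum_distrib_left)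

lemma norm_cdot_le: "cmod (cdot a x) \<le> norm a * norm x"
proof -
  have "cmod (cdot a x) \<le> (\<Sum>i\<in>UNIV. \<bar>cmod (a $ i)\<bar> * \<bar>cmod (x $ i)\<bar>)"
    unfolding cdot_def by (rule order_trans[OF norm_sum]) (simp add: norm_mult)
  also have "\<dots> \<le> norm a * norm x"
    unfolding norm_vec_def by (rule L2_set_mult_ineq)
  finally show ?thesis .
qed

lemma continuous_on_cdot [continuous_intros]:
  "continuous_on S f \<Longrightarrow> continuous_on S (\<lambda>x. cdot a (f x))"
  unfolding cdot_def by (intro continuous_intros)

lemma cdot_eq_1_ex: "x \<noteq> 0 \<Longrightarrow> \<exists>a. cdot a x = 1"
proof -
  assume "x \<noteq> 0"
  then obtain i where "x $ i \<noteq> 0" by (metis vec_eq_iff zero_index)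
  then have "cdot (axis i (1 / x $ i)) x = 1"
    by (simp add: cdot_def axis_def if_distrib[of "\<lambda>a. a * _"] cong: if_cong)
  then show ?thesis by blast
qed

text \<open>The tautological line bundle over the complex projective line has no nowhere vanishing
  section; here a section is given as a function of degree one on the unit sphere.\<close>

lemma no_homogeneous_degree_one:
  fixes H :: "complex^2 \<Rightarrow> complex"
  assumes "continuous_on (sphere 0 1) H" "\<And>e. norm e = 1 \<Longrightarrow> H e \<noteq> 0"
    and deg: "\<And>e t. norm e = 1 \<Longrightarrow> cmod t = 1 \<Longrightarrow> H (t *s e) = t * H e"
  shows False
proof -
  have "simply_connected (sphere (0::complex^2) 1)"
    by (rule simply_connected_sphere) simp
  then obtain G where G: "continuous_on (sphere 0 1) G" "\<And>e. e \<in> sphere 0 1 \<Longrightarrow> H e = exp (G e)"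
    using continuous_logarithm_on_simply_connected[OF assms(1)] assms(2)
      locally_path_connected_sphere
    by (metis (no_types, lifting) dist_0_norm mem_sphere)
  define e where "e = (axis 1 1 :: complex^2)"
  have e: "norm e = 1" by (simp add: e_def)
  \<comment> \<open>Along the circle through \<open>e\<close> the degree condition makes
    \<open>H\<close> wind once around 0. Subtracting the angle from its logarithm leaves a constant,
    yet over a full turn \<open>G\<close> returns to its value while the subtracted term grows by 2
    pi i.\<close>
  define m where "m = (\<lambda>\<theta>::real. G (cis \<theta> *s e) - \<i> * of_real \<theta>)"
  have "continuous_on {0..2*pi} m"
    unfolding m_def
    by (intro continuous_intros continuous_on_compose2[OF G(1)])
       (auto simp: norm_smult e intro!: continuous_intros)
  moreover have "exp (m \<theta>) = H e" for \<theta>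
  proof -
    have "exp (m \<theta>) = H (cis \<theta> *s e) / cis \<theta>"
      using G(2)[of "cis \<theta> *s e"] by (simp add: m_def exp_diff norm_smult e cis_conv_exp)
    then show ?thesis using deg[OF e, of "cis \<theta>"] by simp
  qed
  ultimately have "m 0 = m (2 * pi)"
    by (intro continuous_exp_constant[of "{0..2*pi}" m]) auto
  then show False by (simp add: m_def)
qed

lemma continuous_on_complex_matrix_vector_mult [continuous_intros]:
  fixes A :: "complex^'n^'m"
  shows "continuous_on S f \<Longrightarrow> continuous_on S (\<lambda>x. A *v f x)"
  unfolding matrix_vector_mult_def by (intro continuous_intros)

lemma matrix_vector_smult:
  fixes A :: "complex^'n^'m"
  shows "A *v (c *s x) = c *s (A *v x)" "A *v (x + y) = A *v x + A *v y"
  by (simp_all add: vector_scalar_commute algebra_simps)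

text \<open>\<open>W\<close> collects pairs lying over the same point of the projective line. The
  complex line through \<open>u\<close> and \<open>v\<close> is mapped into the span of the image of
  \<open>u\<close>, and within \<open>D\<close> never to 0; hence a coordinate \<open>b\<close> that
  is nonzero at \<open>u\<close> has no zero on the whole line section.\<close>

lemma fibrewise_logarithm:
  fixes D :: "(complex^'n) set" and \<alpha> :: "complex^'n^2" and b :: "complex^2"
  assumes "open D" "C_convex D" "vec.subspace V"
    and nz: "\<And>x. x \<in> D \<Longrightarrow> x - p \<in> V \<Longrightarrow> \<alpha> *v (x - p) \<noteq> 0"
  defines "W \<equiv> {(u, v). u \<in> D \<and> v \<in> D \<and> u - p \<in> V \<and> v - p \<in> V \<and>
      cdot b (\<alpha> *v (u - p)) \<noteq> 0 \<and> (\<exists>k. \<alpha> *v (v - p) = k *s (\<alpha> *v (u - p)))}"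
  obtains \<Lambda> where "continuous_on W \<Lambda>"
    "\<And>u v. (u, v) \<in> W \<Longrightarrow> exp (\<Lambda> (u, v)) = cdot b (\<alpha> *v (v - p)) / cdot b (\<alpha> *v (u - p))"
proof (rule linewise_logarithm[of D "\<lambda>x. cdot b (\<alpha> *v (x - p))" W])
  show "continuous_on D (\<lambda>x. cdot b (\<alpha> *v (x - p)))"
    by (intro continuous_intros)
  show "W \<subseteq> D \<times> D" by (auto simp: W_def)
  fix u v assume W: "(u, v) \<in> W"
  then show "contractible {t. u + t *s (v - u) \<in> D}"
    using contractible_line_parameters[OF assms(2)] by (auto simp: W_def)
  fix t assume t: "u + t *s (v - u) \<in> D"
  from W obtain k where k: "\<alpha> *v (v - p) = k *s (\<alpha> *v (u - p))" and uv: "u - p \<in> V" "v - p \<in> V"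
    and b: "cdot b (\<alpha> *v (u - p)) \<noteq> 0"
    by (auto simp: W_def)
  have eq: "u + t *s (v - u) - p = (1 - t) *s (u - p) + t *s (v - p)"
    by (simp add: vec_eq_iff algebra_simps)
  have "u + t *s (v - u) - p \<in> V"
    unfolding eq using assms(3) uv by (intro vec.subspace_add vec.subspace_scale)
  then have "\<alpha> *v (u + t *s (v - u) - p) \<noteq> 0" using nz t by blast
  moreover have eq2: "\<alpha> *v (u + t *s (v - u) - p) = (1 - t + t * k) *s (\<alpha> *v (u - p))"
    unfolding eq
    by (simp only: matrix_vector_smult(1,2) k vector_smult_assoc flip: vector_sadd_rdistrib)
  ultimately have "1 - t + t * k \<noteq> 0" by (metis vector_smult_lzero)
  then show "cdot b (\<alpha> *v (u + t *s (v - u) - p)) \<noteq> 0"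
    unfolding eq2 cdot_smult using b by simp
qed (use assms in auto)

section \<open>Complex hyperplanes missing a C-convex domain\<close>

text \<open>A local section over the projective line: \<open>w1\<close> and \<open>w2\<close> give a
  linear right inverse of \<open>\<alpha>\<close> with values in \<open>V\<close>, which is shifted
  to pass through \<open>q\<close>. Since \<open>y\<close> is rescaled to have coordinate 1,
  \<open>s y\<close> depends only on the line spanned by \<open>y\<close>; the norm condition says
  that the rescaled \<open>y\<close> is within \<open>2 * r\<close> of the image of
  \<open>q\<close>. The factor 2 leaves room for a cutoff of radius \<open>r\<close>.\<close>

lemma fibre_section:
  fixes D :: "(complex^'n) set" and \<alpha> :: "complex^'n^2"
  assumes "open D" "vec.subspace V"
    and nz: "\<And>x. x \<in> D \<Longrightarrow> x - p \<in> V \<Longrightarrow> \<alpha> *v (x - p) \<noteq> 0"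
    and w: "w1 \<in> V" "w2 \<in> V" "\<alpha> *v w1 = axis 1 1" "\<alpha> *v w2 = axis 2 1"
    and q: "q \<in> D" "q - p \<in> V"
  shows "\<exists>b r s. 0 < r \<and> cdot b (\<alpha> *v (q - p)) = 1 \<and>
    continuous_on {y. cdot b y \<noteq> 0} s \<and>
    (\<forall>y. cdot b y \<noteq> 0 \<and> norm (y - cdot b y *s (\<alpha> *v (q - p))) < 2 * r * cmod (cdot b y) \<longrightarrow>
       s y \<in> D \<and> s y - p \<in> V \<and> \<alpha> *v (s y - p) = (1 / cdot b y) *s y)"
proof -
  obtain b where b: "cdot b (\<alpha> *v (q - p)) = 1" using cdot_eq_1_ex nz[OF q] by blast
  define \<tau> where "\<tau> = (\<lambda>y::complex^2. y $ 1 *s w1 + y $ 2 *s w2)"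
  have \<tau>V: "\<tau> y \<in> V" for y
    unfolding \<tau>_def using assms(2) w by (intro vec.subspace_add vec.subspace_scale)
  have \<tau>P: "\<alpha> *v \<tau> y = y" for y
    unfolding \<tau>_def by (simp add: matrix_vector_smult w vec_eq_iff forall_2 axis_def)
  define s where "s = (\<lambda>y. q + \<tau> ((1 / cdot b y) *s y - \<alpha> *v (q - p)))"
  have \<tau>c: "continuous_on S (\<lambda>x. \<tau> (f x))" if "continuous_on S f" for f :: "complex^2 \<Rightarrow> _" and S
    unfolding \<tau>_def using that by (intro continuous_intros)
  have "open ((\<lambda>z. q + \<tau> z) -` D)"
    by (intro open_vimage assms(1) continuous_on_add continuous_on_const \<tau>c continuous_on_id)
  moreover have "0 \<in> (\<lambda>z. q + \<tau> z) -` D" using q by (simp add: \<tau>_def)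
  ultimately obtain d where d: "d > 0" "ball 0 d \<subseteq> (\<lambda>z. q + \<tau> z) -` D"
    using open_contains_ball by blast
  show ?thesis
  proof (intro exI conjI allI impI)
    show "0 < d / 2" using d by simp
    show "cdot b (\<alpha> *v (q - p)) = 1" by (rule b)
    show "continuous_on {y. cdot b y \<noteq> 0} s"
      unfolding s_def by (intro continuous_intros \<tau>c) auto
    fix y
    assume y: "cdot b y \<noteq> 0 \<and> norm (y - cdot b y *s (\<alpha> *v (q - p))) < 2 * (d / 2) * cmod (cdot b y)"
    have "(1 / cdot b y) *s y - \<alpha> *v (q - p) = (1 / cdot b y) *s (y - cdot b y *s (\<alpha> *v (q - p)))"
      using y by (simp add: vec_eq_iff field_simps)
    then have "norm ((1 / cdot b y) *s y - \<alpha> *v (q - p)) =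
        norm (y - cdot b y *s (\<alpha> *v (q - p))) / cmod (cdot b y)"
      by (simp only: norm_smult) (simp add: norm_divide)
    also have "\<dots> < d" using y by (subst divide_less_eq) auto
    finally have "(1 / cdot b y) *s y - \<alpha> *v (q - p) \<in> ball 0 d" by simp
    then show "s y \<in> D" unfolding s_def using d(2) by blast
    have eq: "s y - p = (q - p) + \<tau> ((1 / cdot b y) *s y - \<alpha> *v (q - p))"
      by (simp add: s_def)
    show "s y - p \<in> V" unfolding eq using q \<tau>V assms(2) by (intro vec.subspace_add)
    show "\<alpha> *v (s y - p) = (1 / cdot b y) *s y"
      unfolding eq by (subst matrix_vector_smult(2)) (simp add: \<tau>P)
  qed
qed

text \<open>\<open>f\<close> is controlled on \<open>U\<close> only. The sets \<open>U\<close> and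
  \<open>X - C\<close> are relatively open and cover \<open>X\<close>, and on the second one the
  product is identically 0.\<close>

lemma continuous_on_cutoff_mult:
  fixes f :: "'a::metric_space \<Rightarrow> complex"
  assumes "continuous_on X \<rho>" "continuous_on U f" "U \<subseteq> X"
    and "openin (top_of_set X) U" "closedin (top_of_set X) C" "C \<subseteq> U"
    and "\<And>x. x \<in> X \<Longrightarrow> x \<notin> C \<Longrightarrow> \<rho> x = 0"
  shows "continuous_on X (\<lambda>x. \<rho> x * f x)"
proof -
  have X: "U \<union> (X - C) = X" using assms by blast
  have "continuous_on (U \<union> (X - C)) (\<lambda>x. \<rho> x * f x)"
  proof (rule continuous_on_Un_local_open)
    show "openin (top_of_set (U \<union> (X - C))) U" using assms X by simp
    show "openin (top_of_set (U \<union> (X - C))) (X - C)"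
      unfolding X using assms by (auto intro: openin_diff)
    show "continuous_on U (\<lambda>x. \<rho> x * f x)"
      by (intro continuous_on_mult continuous_on_subset[OF assms(1)] assms)
    have "continuous_on (X - C) (\<lambda>x. 0)" by (rule continuous_on_const)
    then show "continuous_on (X - C) (\<lambda>x. \<rho> x * f x)"
      by (rule continuous_on_eq) (use assms in auto)
  qed
  then show ?thesis by (simp only: X)
qed

text \<open>If every complex line through the origin of the quotient plane met the image of D, the
  logarithms of the fibre coordinate, glued by a partition of unity that is constant on the
  fibres, would yield a function of degree one.\<close>

lemma C_convex_quotient_plane:
  fixes D :: "(complex^'n) set" and \<alpha> :: "complex^'n^2"
  assumes D: "open D" "C_convex D" and V: "vec.subspace V"
    and nz: "\<And>x. x \<in> D \<Longrightarrow> x - p \<in> V \<Longrightarrow> \<alpha> *v (x - p) \<noteq> 0"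
    and hit: "\<And>e. e \<noteq> 0 \<Longrightarrow> \<exists>x\<in>D. x - p \<in> V \<and> (\<exists>c. \<alpha> *v (x - p) = c *s e)"
  shows False
proof -
  define P where "P = (\<lambda>x. \<alpha> *v (x - p))"
  define S where "S = {x \<in> D. x - p \<in> V}"
  have P_fold: "\<alpha> *v (x - p) = P x" for x by (simp add: P_def)
  have Pnz: "P x \<noteq> 0" if "x \<in> S" for x using nz that by (auto simp: P_def S_def)
  have Pc: "continuous_on X (\<lambda>x. P (g x))" if "continuous_on X g" for X :: "'x::topological_space set" and g
    unfolding P_def using that by (intro continuous_intros)
  have hitS: "\<exists>x\<in>S. \<exists>c. c \<noteq> 0 \<and> P x = c *s e" if "e \<noteq> 0" for e
    using hit[OF that] Pnz unfolding S_def P_def by force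
  obtain x1 c1 where x1: "x1 \<in> S" "c1 \<noteq> 0" "P x1 = c1 *s axis 1 1"
    using hitS[of "axis 1 1"] by auto
  obtain x2 c2 where x2: "x2 \<in> S" "c2 \<noteq> 0" "P x2 = c2 *s axis 2 1"
    using hitS[of "axis 2 1"] by auto
  \<comment> \<open>Points of \<open>D\<close> over the two coordinate axes give preimages in
    \<open>V\<close> of the basis vectors, so \<open>\<alpha>\<close> maps \<open>V\<close> onto the
    plane.\<close>
  define w1 w2 where "w1 = (1 / c1) *s (x1 - p)" and "w2 = (1 / c2) *s (x2 - p)"
  have w: "w1 \<in> V" "w2 \<in> V" "\<alpha> *v w1 = axis 1 1" "\<alpha> *v w2 = axis 2 1"
  proof -
    show "w1 \<in> V" unfolding w1_def
      by (rule vec.subspace_scale[OF V]) (use x1 in \<open>simp add: S_def\<close>)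
    show "w2 \<in> V" unfolding w2_def
      by (rule vec.subspace_scale[OF V]) (use x2 in \<open>simp add: S_def\<close>)
    show "\<alpha> *v w1 = axis 1 1"
      using x1 by (simp only: w1_def matrix_vector_smult(1) P_def) (simp add: vector_smult_assoc)
    show "\<alpha> *v w2 = axis 2 1"
      using x2 by (simp only: w2_def matrix_vector_smult(1) P_def) (simp add: vector_smult_assoc)
  qed
  define local_section where "local_section = (\<lambda>q b r s. 0 < (r::real) \<and> cdot b (P q) = 1 \<and>
    continuous_on {y. cdot b y \<noteq> 0} s \<and>
    (\<forall>y. cdot b y \<noteq> 0 \<and> norm (y - cdot b y *s P q) < 2 * r * cmod (cdot b y) \<longrightarrow>
       s y \<in> S \<and> P (s y) = (1 / cdot b y) *s y))"
  have "\<exists>b r s. local_section q b r s" if "q \<in> S" for q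
    using fibre_section[OF D(1) V nz w, of q] that by (simp add: local_section_def P_def S_def)
  then obtain b r s where "\<And>q. q \<in> S \<Longrightarrow> local_section q (b q) (r q) (s q)"
    by metis
  note loc = this[unfolded local_section_def]
  have r: "0 < r q" and b: "cdot (b q) (P q) = 1"
    and sc: "continuous_on {y. cdot (b q) y \<noteq> 0} (s q)" if "q \<in> S" for q
    using loc[OF that] by simp_all
  have sS: "s q y \<in> S" and sP: "P (s q y) = (1 / cdot (b q) y) *s y"
    if "q \<in> S" "cdot (b q) y \<noteq> 0"
      "norm (y - cdot (b q) y *s P q) < 2 * r q * cmod (cdot (b q) y)" for q y
    using loc[OF that(1)] that(2,3) by simp_all
  define W where "W = (\<lambda>q. {(u, v). u \<in> D \<and> v \<in> D \<and> u - p \<in> V \<and> v - p \<in> V \<and>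
      cdot (b q) (\<alpha> *v (u - p)) \<noteq> 0 \<and> (\<exists>k. \<alpha> *v (v - p) = k *s (\<alpha> *v (u - p)))})"
  have "\<exists>\<Lambda>. continuous_on (W q) \<Lambda> \<and>
    (\<forall>u v. (u, v) \<in> W q \<longrightarrow> exp (\<Lambda> (u, v)) = cdot (b q) (P v) / cdot (b q) (P u))" for q
    unfolding W_def P_def by (rule fibrewise_logarithm[OF D V nz, where b = "b q"]) blast+
  then obtain \<Lambda> where \<Lambda>c: "\<And>q. continuous_on (W q) (\<Lambda> q)"
    and \<Lambda>e: "\<And>q u v. (u, v) \<in> W q \<Longrightarrow> exp (\<Lambda> q (u, v)) = cdot (b q) (P v) / cdot (b q) (P u)"
    by metis
  \<comment> \<open>Positive exactly when \<open>y\<close>, rescaled to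
    \<open>cdot (b q) y = 1\<close>, is within \<open>r q\<close> of \<open>P q\<close>. A scalar
    factor multiplies it by its modulus, so in the quotient \<open>\<rho>\<close> below all scaling
    drops out.\<close>
  define \<psi> where "\<psi> = (\<lambda>q y. max 0 (r q * cmod (cdot (b q) y) - norm (y - cdot (b q) y *s P q)))"
  have \<psi>0: "0 \<le> \<psi> q y" for q y by (simp add: \<psi>_def)
  have \<psi>c: "continuous_on X (\<lambda>x. \<psi> q (g x))" if "continuous_on X g"
    for X :: "'x::topological_space set" and g q
    unfolding \<psi>_def using that by (intro continuous_intros)
  have \<psi>h: "\<psi> q (c *s y) = cmod c * \<psi> q y" for q c y
  proof -
    have "c *s y - cdot (b q) (c *s y) *s P q = c *s (y - cdot (b q) y *s P q)"
      by (simp add: cdot_smult vec_eq_iff algebra_simps)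
    then show ?thesis
      by (simp only: \<psi>_def norm_smult cdot_smult norm_mult)
         (simp add: max_mult_distrib_left algebra_simps)
  qed
  have \<psi>pos: "cdot (b q) y \<noteq> 0 \<and> norm (y - cdot (b q) y *s P q) < 2 * r q * cmod (cdot (b q) y)"
    if "\<psi> q y > 0" "q \<in> S" for q y
  proof -
    have lt: "norm (y - cdot (b q) y *s P q) < r q * cmod (cdot (b q) y)"
      using that by (simp add: \<psi>_def)
    have "cdot (b q) y \<noteq> 0"
    proof
      assume "cdot (b q) y = 0"
      with lt have "norm (y - cdot (b q) y *s P q) < 0" by simp
      then show False by simp
    qed
    moreover have "0 \<le> r q * cmod (cdot (b q) y)" using r[OF that(2)] by simp
    ultimately show ?thesis using lt by linarith
  qed
  have "\<exists>Q\<subseteq>S. finite Q \<and> sphere 0 1 \<subseteq> (\<Union>q\<in>Q. {y. \<psi> q y > 0})"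
  proof -
    have "open {y. \<psi> q y > 0}" for q
      using \<psi>c[of UNIV "\<lambda>x. x"] by (auto intro!: open_Collect_less continuous_intros)
    moreover have "sphere 0 1 \<subseteq> (\<Union>q\<in>S. {y. \<psi> q y > 0})"
    proof
      fix e :: "complex^2" assume "e \<in> sphere 0 1"
      then have "e \<noteq> 0" by auto
      then obtain q c where q: "q \<in> S" "c \<noteq> 0" "P q = c *s e" using hitS by blast
      have "cmod c * \<psi> q e = \<psi> q (P q)" using q \<psi>h by simp
      also have "\<dots> > 0" using r[OF q(1)] b[OF q(1)] by (simp add: \<psi>_def)
      finally have "\<psi> q e > 0" using q(2) by (simp add: zero_less_mult_iff)
      with q show "e \<in> (\<Union>q\<in>S. {y. \<psi> q y > 0})" by blast
    qed
    ultimately show ?thesis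
      using compactE_image[OF compact_sphere[of "0::complex^2" 1], of S "\<lambda>q. {y. \<psi> q y > 0}"] by metis
  qed
  then obtain Q where Q: "Q \<subseteq> S" "finite Q" "sphere 0 1 \<subseteq> (\<Union>q\<in>Q. {y. \<psi> q y > 0})" by blast
  define \<Psi> where "\<Psi> = (\<lambda>y. \<Sum>q\<in>Q. \<psi> q y)"
  have \<Psi>h: "\<Psi> (c *s y) = cmod c * \<Psi> y" for c y
    by (simp add: \<Psi>_def \<psi>h sum_distrib_left)
  have \<Psi>pos: "\<Psi> y > 0" if y: "y \<noteq> 0" for y
  proof -
    define e where "e = of_real (1 / norm y) *s y"
    have "norm e = 1" using y by (simp add: e_def norm_smult norm_divide)
    then obtain q where "q \<in> Q" "\<psi> q e > 0" using Q(3) by fastforce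
    then have "\<Psi> e > 0" unfolding \<Psi>_def using Q(2) \<psi>0 by (intro sum_pos2) auto
    then have "0 < cmod (of_real (1 / norm y)) * \<Psi> y" unfolding e_def \<Psi>h .
    then show ?thesis using y by (simp add: zero_less_mult_iff)
  qed
  define \<rho> where "\<rho> = (\<lambda>q y. \<psi> q y / \<Psi> y)"
  have \<rho>sum: "(\<Sum>q\<in>Q. \<rho> q y) = 1" if "y \<noteq> 0" for y
    using \<Psi>pos[OF that] by (simp add: \<rho>_def \<Psi>_def flip: sum_divide_distrib)
  have \<rho>h: "\<rho> q (c *s y) = \<rho> q y" if "c \<noteq> 0" for q c y
    using that by (simp add: \<rho>_def \<psi>h \<Psi>h)
  \<comment> \<open>The base point in each fibre is the value of the section, where the coordinate
    \<open>b q\<close> equals 1. Thus \<open>lg q x\<close> is a logarithm of the coordinate of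
    \<open>P x\<close> itself and is continuous across fibres as well as along them.\<close>
  define lg where "lg = (\<lambda>q x. \<Lambda> q (s q (P x), x))"
  define U where "U = (\<lambda>q. {x \<in> S. cdot (b q) (P x) \<noteq> 0 \<and>
      norm (P x - cdot (b q) (P x) *s P q) < 2 * r q * cmod (cdot (b q) (P x))})"
  have inW: "(s q (P x), x) \<in> W q" if q: "q \<in> S" and x: "x \<in> U q" for q x
  proof -
    from x have x': "x \<in> S" "cdot (b q) (P x) \<noteq> 0"
      "norm (P x - cdot (b q) (P x) *s P q) < 2 * r q * cmod (cdot (b q) (P x))"
      by (auto simp: U_def)
    have "P x = cdot (b q) (P x) *s P (s q (P x))"
      using sP[OF q x'(2,3)] x'(2) by (simp add: vector_smult_assoc)
    moreover have "cdot (b q) (P (s q (P x))) = 1"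
      using sP[OF q x'(2,3)] x'(2) by (simp add: cdot_smult)
    ultimately show ?thesis
      using sS[OF q x'(2,3)] x'(1) by (auto simp: W_def S_def P_fold)
  qed
  have lge: "exp (lg q x) = cdot (b q) (P x)" if q: "q \<in> S" and x: "x \<in> U q" for q x
  proof -
    from x have x': "cdot (b q) (P x) \<noteq> 0"
      "norm (P x - cdot (b q) (P x) *s P q) < 2 * r q * cmod (cdot (b q) (P x))"
      by (auto simp: U_def)
    have "cdot (b q) (P (s q (P x))) = 1"
      using sP[OF q x'] x'(1) by (simp add: cdot_smult)
    with \<Lambda>e[OF inW[OF q x]] show ?thesis by (simp add: lg_def)
  qed
  have lgc: "continuous_on (U q) (lg q)" if q: "q \<in> S" for q
    unfolding lg_def
  proof (rule continuous_on_compose2[OF \<Lambda>c])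
    show "continuous_on (U q) (\<lambda>x. (s q (P x), x))"
      by (intro continuous_on_Pair continuous_on_id continuous_on_compose2[OF sc[OF q]] Pc)
         (auto simp: U_def)
    show "(\<lambda>x. (s q (P x), x)) ` U q \<subseteq> W q" using inW[OF q] by blast
  qed
  \<comment> \<open>A weighted geometric mean of the coordinates \<open>cdot (b q) (P x)\<close>.
    Each of them scales by \<open>k\<close> when \<open>P x\<close> does, and the weights sum to 1,
    which makes \<open>h\<close> homogeneous of degree one.\<close>
  define h where "h = (\<lambda>x. exp (\<Sum>q\<in>Q. of_real (\<rho> q (P x)) * lg q x))"
  have hc: "continuous_on S h"
    unfolding h_def
  proof (intro continuous_on_exp continuous_on_sum)
    fix q assume "q \<in> Q"
    then have q: "q \<in> S" using Q by blast
    define C where "C = {x \<in> S. norm (P x - cdot (b q) (P x) *s P q) \<le> r q * cmod (cdot (b q) (P x))}"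
    show "continuous_on S (\<lambda>x. of_real (\<rho> q (P x)) * lg q x)"
    proof (rule continuous_on_cutoff_mult[OF _ lgc[OF q]])
      have "\<Psi> (P x) \<noteq> 0" if "x \<in> S" for x using \<Psi>pos[OF Pnz[OF that]] by simp
      moreover have "continuous_on S (\<lambda>x. \<Psi> (P x))"
        unfolding \<Psi>_def by (intro continuous_on_sum \<psi>c Pc continuous_on_id)
      ultimately show "continuous_on S (\<lambda>x. complex_of_real (\<rho> q (P x)))"
        unfolding \<rho>_def by (intro continuous_intros \<psi>c Pc) auto
      show "U q \<subseteq> S" by (auto simp: U_def)
      have "U q = S \<inter> ({x. cdot (b q) (P x) \<noteq> 0} \<inter>
          {x. norm (P x - cdot (b q) (P x) *s P q) < 2 * r q * cmod (cdot (b q) (P x))})"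
        by (auto simp: U_def)
      moreover have "open ({x. cdot (b q) (P x) \<noteq> 0} \<inter>
          {x. norm (P x - cdot (b q) (P x) *s P q) < 2 * r q * cmod (cdot (b q) (P x))})"
        by (intro open_Int open_Collect_less open_Collect_neq continuous_intros Pc)
      ultimately show "openin (top_of_set S) (U q)" by (auto simp: openin_open)
      have "C = S \<inter> {x. norm (P x - cdot (b q) (P x) *s P q) \<le> r q * cmod (cdot (b q) (P x))}"
        by (auto simp: C_def)
      moreover have "closed {x. norm (P x - cdot (b q) (P x) *s P q) \<le> r q * cmod (cdot (b q) (P x))}"
        by (intro closed_Collect_le continuous_intros Pc)
      ultimately show "closedin (top_of_set S) C" by (auto simp: closedin_closed)
      show "C \<subseteq> U q"
      proof
        fix x assume x: "x \<in> C"
        have "cdot (b q) (P x) \<noteq> 0"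
        proof
          assume "cdot (b q) (P x) = 0"
          with x have "P x = 0" by (simp add: C_def)
          with x Pnz show False by (auto simp: C_def)
        qed
        moreover from this r[OF q] have "0 < r q * cmod (cdot (b q) (P x))" by simp
        ultimately show "x \<in> U q" using x unfolding C_def U_def by simp
      qed
      show "complex_of_real (\<rho> q (P x)) = 0" if "x \<in> S" "x \<notin> C" for x
        using that by (auto simp: C_def \<rho>_def \<psi>_def)
    qed
  qed
  have hnz: "h x \<noteq> 0" for x by (simp add: h_def)
  have hfib: "h x' = k * h x" if x: "x \<in> S" "x' \<in> S" and k: "P x' = k *s P x" for x x' k
  proof -
    have k0: "k \<noteq> 0" using Pnz[OF x(2)] k by auto
    define A where "A = {z. z - p \<in> V \<and> (\<exists>c. P z = c *s P x)}"
    define F where "F = D \<inter> A"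
    have "connected F"
      unfolding F_def
    proof (rule connected_C_convex_Int[OF D(2)])
      fix u v t assume uv: "u \<in> A" "v \<in> A"
      then obtain cu cv where c: "P u = cu *s P x" "P v = cv *s P x" by (auto simp: A_def)
      have eq: "u + t *s (v - u) - p = (1 - t) *s (u - p) + t *s (v - p)"
        by (simp add: vec_eq_iff algebra_simps)
      have "u + t *s (v - u) - p \<in> V"
        unfolding eq using V uv by (intro vec.subspace_add vec.subspace_scale) (auto simp: A_def)
      moreover have "P (u + t *s (v - u)) = ((1 - t) * cu + t * cv) *s P x"
      proof -
        have "P (u + t *s (v - u)) = (1 - t) *s P u + t *s P v"
          by (simp only: P_def eq matrix_vector_smult(1,2))
        also have "\<dots> = ((1 - t) * cu + t * cv) *s P x"
          unfolding c by (simp only: vector_smult_assoc vector_sadd_rdistrib)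
        finally show ?thesis .
      qed
      ultimately show "u + t *s (v - u) \<in> A" unfolding A_def by blast
    qed
    have FS: "F \<subseteq> S" by (auto simp: F_def A_def S_def)
    have xF: "x \<in> F" "x' \<in> F"
      using x k by (auto simp: F_def A_def S_def intro: exI[of _ 1])
    have Fc: "\<exists>c. c \<noteq> 0 \<and> P z = c *s P x" if "z \<in> F" for z
    proof -
      have "\<exists>c. P z = c *s P x" using that by (simp add: F_def A_def)
      then obtain c where "P z = c *s P x" ..
      moreover have "P z \<noteq> 0" using Pnz FS that by blast
      ultimately show ?thesis by (metis vector_smult_lzero)
    qed
    define Qx where "Qx = {q \<in> Q. \<psi> q (P x) > 0}"
    have FU: "F \<subseteq> U q" if "q \<in> Qx" for q
    proof
      fix z assume z: "z \<in> F"
      obtain c where c: "c \<noteq> 0" "P z = c *s P x" using Fc[OF z] by blast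
      have "\<psi> q (P z) > 0" using that c by (simp add: \<psi>h Qx_def)
      with \<psi>pos[of q "P z"] that Q(1) z FS show "z \<in> U q" by (auto simp: U_def Qx_def)
    qed
    have QxS: "q \<in> S" if "q \<in> Qx" for q using that Q by (auto simp: Qx_def)
    have "\<Psi> (P x) > 0" using \<Psi>pos Pnz x by blast
    then have "\<exists>q\<in>Q. \<psi> q (P x) > 0"
      unfolding \<Psi>_def using \<psi>0 by (metis (no_types, lifting) less_irrefl order_le_less sum.neutral)
    then obtain q0 where q0: "q0 \<in> Qx" by (auto simp: Qx_def)
    define \<delta> where "\<delta> = lg q0 x' - lg q0 x"
    \<comment> \<open>\<open>lg q\<close> and \<open>lg q0\<close> are logarithms of two coordinates
      whose ratio is constant on \<open>F\<close>, the part of \<open>D\<close> over one complex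
      line, and \<open>F\<close> is connected. So all branches change by the same amount from
      \<open>x\<close> to \<open>x'\<close>.\<close>
    have same: "lg q x' - lg q x = \<delta>" if q: "q \<in> Qx" for q
    proof -
      have "lg q x' - lg q0 x' = lg q x - lg q0 x"
      proof (rule continuous_exp_constant[OF \<open>connected F\<close>])
        show "continuous_on F (\<lambda>z. lg q z - lg q0 z)"
          using FU q q0 QxS by (intro continuous_on_diff continuous_on_subset[OF lgc])
        fix z assume z: "z \<in> F"
        obtain c where c: "c \<noteq> 0" "P z = c *s P x" using Fc[OF z] by blast
        show "exp (lg q z - lg q0 z) = cdot (b q) (P x) / cdot (b q0) (P x)"
          using lge[OF QxS[OF q] subsetD[OF FU[OF q] z]]
            lge[OF QxS[OF q0] subsetD[OF FU[OF q0] z]] c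
          by (simp add: exp_diff cdot_smult)
      qed (use xF in auto)
      then show ?thesis by (simp add: \<delta>_def algebra_simps)
    qed
    have "exp \<delta> = k"
      using lge[OF QxS[OF q0] subsetD[OF FU[OF q0] xF(1)]]
        lge[OF QxS[OF q0] subsetD[OF FU[OF q0] xF(2)]] k subsetD[OF FU[OF q0] xF(1)]
      by (simp add: \<delta>_def exp_diff cdot_smult U_def)
    moreover have "(\<Sum>q\<in>Q. of_real (\<rho> q (P x')) * lg q x') = (\<Sum>q\<in>Q. of_real (\<rho> q (P x)) * lg q x) + \<delta>"
    proof -
      have "(\<Sum>q\<in>Q. of_real (\<rho> q (P x')) * lg q x') - (\<Sum>q\<in>Q. of_real (\<rho> q (P x)) * lg q x)
          = (\<Sum>q\<in>Q. of_real (\<rho> q (P x)) * (lg q x' - lg q x))"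
        using \<rho>h[OF k0] k by (simp add: sum_subtractf algebra_simps)
      also have "\<dots> = (\<Sum>q\<in>Q. of_real (\<rho> q (P x)) * \<delta>)"
      proof (rule sum.cong[OF refl])
        fix q assume q: "q \<in> Q"
        show "of_real (\<rho> q (P x)) * (lg q x' - lg q x) = of_real (\<rho> q (P x)) * \<delta>"
        proof (cases "q \<in> Qx")
          case False
          then have "\<psi> q (P x) = 0" using q \<psi>0[of q "P x"] by (auto simp: Qx_def)
          then show ?thesis by (simp add: \<rho>_def)
        qed (simp add: same)
      qed
      also have "\<dots> = of_real (\<Sum>q\<in>Q. \<rho> q (P x)) * \<delta>"
        by (simp add: sum_distrib_right)
      also have "\<dots> = \<delta>" using \<rho>sum[OF Pnz[OF x(1)]] by simp
      finally show ?thesis by (simp add: algebra_simps)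
    qed
    ultimately show ?thesis by (simp add: h_def exp_add)
  qed
  have "\<exists>X C. \<forall>e. e \<noteq> 0 \<longrightarrow> X e \<in> S \<and> C e \<noteq> 0 \<and> P (X e) = C e *s e"
    using hitS by metis
  then obtain X C where X: "\<And>e. e \<noteq> 0 \<Longrightarrow> X e \<in> S" "\<And>e. e \<noteq> 0 \<Longrightarrow> C e \<noteq> 0"
    "\<And>e. e \<noteq> 0 \<Longrightarrow> P (X e) = C e *s e" by blast
  \<comment> \<open>By \<open>hfib\<close> the quotient is the same for every point of
    \<open>S\<close> over the line of \<open>e\<close>; it is \<open>h\<close> regarded as a
    function on the plane without its origin.\<close>
  define H where "H = (\<lambda>e. h (X e) / C e)"
  have Hx: "H e = h x / c" if "e \<noteq> 0" "x \<in> S" "P x = c *s e" "c \<noteq> 0" for e x c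
  proof -
    have "P x = (c / C e) *s P (X e)"
      using X[OF that(1)] that by (simp add: vector_smult_assoc)
    then have "h x = (c / C e) * h (X e)" using hfib X that by blast
    then show ?thesis using X(2)[OF that(1)] that(4) by (simp add: H_def)
  qed
  show False
  proof (rule no_homogeneous_degree_one[of H])
    show "continuous_on (sphere 0 1) H"
      unfolding continuous_on_eq_continuous_within
    proof
      fix e :: "complex^2" assume e: "e \<in> sphere 0 1"
      then obtain q where q: "q \<in> Q" "\<psi> q e > 0" using Q(3) by blast
      have qS: "q \<in> S" using q Q by blast
      define O' where "O' = {y. \<psi> q y > 0}"
      have O': "open O'" "e \<in> O'"
        using \<psi>c[of UNIV "\<lambda>x. x" q] q unfolding O'_def by (auto intro!: open_Collect_less continuous_intros)
      \<comment> \<open>Near \<open>e\<close> the section chooses the point over the line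
        continuously; its image is \<open>y\<close> divided by \<open>cdot (b q) y\<close>, which
        explains the factor.\<close>
      have "continuous_on O' (\<lambda>y. h (s q y) * cdot (b q) y)"
        by (intro continuous_intros continuous_on_compose2[OF hc] continuous_on_subset[OF sc[OF qS]])
           (use \<psi>pos sS qS in \<open>auto simp: O'_def\<close>)
      moreover have "h (s q y) * cdot (b q) y = H y" if "y \<in> O'" for y
      proof -
        have y: "cdot (b q) y \<noteq> 0" "norm (y - cdot (b q) y *s P q) < 2 * r q * cmod (cdot (b q) y)"
          using \<psi>pos qS that by (auto simp: O'_def)
        then have "y \<noteq> 0" by auto
        then have "H y = h (s q y) / (1 / cdot (b q) y)"
          by (rule Hx) (use sS[OF qS y] sP[OF qS y] y in auto)
        then show ?thesis by simp
      qed
      ultimately have "continuous_on O' H" by (rule continuous_on_eq)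
      then have "isCont H e" using O' continuous_on_eq_continuous_at by blast
      then show "continuous (at e within sphere 0 1) H"
        by (rule continuous_at_imp_continuous_at_within)
    qed
    fix e :: "complex^2" assume "norm e = 1"
    then have e: "e \<noteq> 0" by auto
    show "H e \<noteq> 0" using hnz X(2)[OF e] by (simp add: H_def)
    fix t assume "cmod t = 1"
    then have t: "t \<noteq> 0" by auto
    have "H (t *s e) = h (X e) / (C e / t)"
      by (rule Hx) (use e t X[OF e] in \<open>auto simp: vector_smult_assoc\<close>)
    then show "H (t *s e) = t * H e" by (simp add: H_def)
  qed
qed

text \<open>Least cardinality is what makes every line hit: when two members are replaced by a
  single combination of them, the smaller family must have a common zero on \<open>D - p\<close>,
  and the combination prescribes the line on which the image of that point lies.\<close>

theorem C_convex_complex_hyperplane: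
  fixes D :: "(complex^'n) set"
  assumes "open D" "C_convex D" "D \<noteq> {}" "p \<notin> D"
  obtains a where "\<And>x. x \<in> D \<Longrightarrow> cdot a (x - p) \<noteq> 0"
proof -
  define ok where "ok = (\<lambda>A. finite A \<and> (\<forall>x\<in>D. \<exists>a\<in>A. cdot a (x - p) \<noteq> 0))"
  \<comment> \<open>The coordinate functionals have only the common zero 0, which
    \<open>x - p\<close> never is because \<open>p\<close> lies outside \<open>D\<close>.\<close>
  have "ok (range (\<lambda>i. axis i 1))"
    unfolding ok_def
  proof (intro conjI ballI)
    fix x assume "x \<in> D"
    with assms(4) have "x - p \<noteq> 0" by auto
    then obtain i where "(x - p) $ i \<noteq> 0" by (metis vec_eq_iff zero_index)
    moreover have "cdot (axis i 1) (x - p) = (x - p) $ i"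
      by (simp add: cdot_def axis_def if_distrib[of "\<lambda>a. a * _"] cong: if_cong)
    ultimately show "\<exists>a\<in>range (\<lambda>i. axis i 1). cdot a (x - p) \<noteq> 0"
      by (metis rangeI)
  qed simp
  then obtain A where A: "ok A" and least: "\<And>B. ok B \<Longrightarrow> card A \<le> card B"
    using ex_has_least_nat[of ok _ card] by metis
  have fin: "finite A" using A by (simp add: ok_def)
  have "A \<noteq> {}" using A assms(3) by (auto simp: ok_def)
  then obtain a1 where a1: "a1 \<in> A" by blast
  show thesis
  proof (cases "A = {a1}")
    case True
    with A that show ?thesis by (auto simp: ok_def)
  next
    case False
    with a1 obtain a2 where a2: "a2 \<in> A" "a2 \<noteq> a1" by blast
    define B where "B = A - {a1, a2}"
    have cardA: "card A = card B + 2"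
      using a1 a2 fin card_Diff_subset[of "{a1, a2}" A] card_mono[of A "{a1, a2}"]
      by (simp add: B_def)
    define V where "V = {v. \<forall>b\<in>B. cdot b v = 0}"
    define \<alpha> :: "complex^'n^2" where "\<alpha> = (\<chi> i. if i = 1 then a1 else a2)"
    have \<alpha>: "(\<alpha> *v v) $ 1 = cdot a1 v" "(\<alpha> *v v) $ 2 = cdot a2 v" for v
      by (simp_all add: matrix_vector_mult_def \<alpha>_def cdot_def)
    have False
    proof (rule C_convex_quotient_plane[OF assms(1,2), of V p \<alpha>])
      show "vec.subspace V"
        by (simp add: vec.subspace_def V_def cdot_add cdot_smult)
      fix x assume x: "x \<in> D" "x - p \<in> V"
      then obtain a where "a \<in> A" "cdot a (x - p) \<noteq> 0" using A by (auto simp: ok_def)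
      with x have "cdot a1 (x - p) \<noteq> 0 \<or> cdot a2 (x - p) \<noteq> 0" by (auto simp: V_def B_def)
      then show "\<alpha> *v (x - p) \<noteq> 0" using \<alpha>[of "x - p"] by (metis zero_index)
    next
      fix e :: "complex^2" assume e: "e \<noteq> 0"
      \<comment> \<open>Up to sign the determinant of \<open>e\<close> and the pair of values of
        \<open>a1\<close> and \<open>a2\<close>: it vanishes exactly when that pair is a multiple of
        \<open>e\<close>.\<close>
      define a' where "a' = e $ 2 *s a1 - e $ 1 *s a2"
      have "finite B" using fin by (simp add: B_def)
      then have "card (insert a' B) < card A"
        using cardA card_insert_le_m1[of "card B + 1" B a'] by (simp add: card_insert_if)
      then have "\<not> ok (insert a' B)" using least[of "insert a' B"] by linarith
      then obtain x where x: "x \<in> D" "\<And>b. b \<in> insert a' B \<Longrightarrow> cdot b (x - p) = 0"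
        using \<open>finite B\<close> by (auto simp: ok_def)
      define y where "y = \<alpha> *v (x - p)"
      have y: "e $ 2 * y $ 1 = e $ 1 * y $ 2"
        using x(2)[of a'] unfolding a'_def y_def \<alpha>
        by (simp only: cdot_diff_left cdot_smult_left) simp
      have "\<exists>c. y = c *s e"
      proof (cases "e $ 1 = 0")
        case True
        then have "e $ 2 \<noteq> 0" using e by (auto simp: vec_eq_iff forall_2)
        with y True show ?thesis
          by (intro exI[of _ "y $ 2 / e $ 2"]) (auto simp: vec_eq_iff forall_2)
      next
        case False
        with y show ?thesis
          by (intro exI[of _ "y $ 1 / e $ 1"]) (auto simp: vec_eq_iff forall_2 field_simps)
      qed
      moreover have "x - p \<in> V" using x(2) by (simp add: V_def)
      ultimately show "\<exists>x\<in>D. x - p \<in> V \<and> (\<exists>c. \<alpha> *v (x - p) = c *s e)"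
        using x(1) unfolding y_def by blast
    qed
    then show ?thesis ..
  qed
qed

section \<open>Projection of the domain to a simply connected planar domain\<close>

text \<open>By the winding number criterion it suffices to find, for each omitted \<open>c\<close>,
  a continuous logarithm of z - c on the image. A logarithm of \<open>cdot a x - c\<close> on
  \<open>D\<close> descends because the fibres of \<open>cdot a\<close> in \<open>D\<close> are
  connected.\<close>

lemma C_convex_projection:
  fixes D :: "(complex^'n) set"
  assumes D: "open D" "C_convex D" "D \<noteq> {}" and "a \<noteq> 0"
  shows "open (cdot a ` D)" "simply_connected (cdot a ` D)"
proof -
  define G where "G = cdot a ` D"
  obtain v where "cdot v a = 1" using cdot_eq_1_ex assms(4) by blast
  then have v: "cdot a v = 1" by (simp add: cdot_def mult.commute)
  \<comment> \<open>An affine right inverse of \<open>cdot a\<close> through \<open>x\<close>. It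
    lifts a neighbourhood of \<open>cdot a x\<close> to \<open>D\<close>, which gives both openness
    of the image and continuity of functions that descend to it.\<close>
  define T where "T = (\<lambda>x z. (z - cdot a x) *s v + x)"
  have T: "cdot a (T x z) = z" "T x (cdot a x) = x" for x z
    by (simp_all only: T_def cdot_add cdot_smult v) simp_all
  have Tc: "continuous_on S (T x)" for S x unfolding T_def by (intro continuous_intros)
  have Topen: "open (T x -` D)" for x by (intro open_vimage D Tc)
  have TG: "T x -` D \<subseteq> G" for x using T(1) unfolding G_def by (metis imageI subsetI vimage_eq)
  show "open (cdot a ` D)"
    unfolding G_def[symmetric]
  proof (subst open_subopen, intro ballI)
    fix z assume "z \<in> G"
    then obtain x where "x \<in> D" "z = cdot a x" by (auto simp: G_def)
    then show "\<exists>T. open T \<and> z \<in> T \<and> T \<subseteq> G"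
      using Topen TG T by (intro exI[of _ "T x -` D"]) auto
  qed
  then have "open G" by (simp add: G_def)
  have "connected D" using connected_C_convex_Int[OF D(2), of UNIV] by simp
  then have "connected G"
    unfolding G_def by (intro connected_continuous_image continuous_intros)
  moreover have "winding_number \<gamma> c = 0"
    if \<gamma>: "path \<gamma>" "path_image \<gamma> \<subseteq> G" "pathfinish \<gamma> = pathstart \<gamma>" and c: "c \<notin> G" for \<gamma> c
  proof -
    define f where "f = (\<lambda>x. cdot a x - c)"
    have fnz: "f x \<noteq> 0" if "x \<in> D" for x using c that by (auto simp: f_def G_def)
    obtain x0 where x0: "x0 \<in> D" using D by blast
    have "continuous_on D f" unfolding f_def by (intro continuous_intros)
    then obtain \<Lambda> where \<Lambda>: "continuous_on ({x0} \<times> D) \<Lambda>"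
      "\<And>u v. (u, v) \<in> {x0} \<times> D \<Longrightarrow> exp (\<Lambda> (u, v)) = f v / f u"
      by (rule linewise_logarithm[OF D(1), where W = "{x0} \<times> D"])
         (use fnz x0 contractible_line_parameters[OF D(2)] in auto)
    \<comment> \<open>With one end fixed at \<open>x0\<close> the increments form a single logarithm
      on all of \<open>D\<close>, since every point shares a line with \<open>x0\<close>; the added
      term corrects the value at \<open>x0\<close>.\<close>
    define g0 where "g0 = (\<lambda>x. \<Lambda> (x0, x) + Ln (f x0))"
    have g0c: "continuous_on D g0"
      unfolding g0_def
      by (intro continuous_intros continuous_on_compose2[OF \<Lambda>(1)]) auto
    have g0e: "exp (g0 x) = f x" if "x \<in> D" for x
      using \<Lambda>(2)[of x0 x] that fnz[OF x0] by (simp add: g0_def exp_add)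
    have g0f: "g0 x = g0 y" if "x \<in> D" "y \<in> D" "cdot a x = cdot a y" for x y
    proof (rule continuous_exp_constant[where S = "D \<inter> {z. cdot a z = cdot a x}" and c = "f x"])
      show "connected (D \<inter> {z. cdot a z = cdot a x})"
      proof (rule connected_C_convex_Int[OF D(2)])
        fix u v t assume "u \<in> {z. cdot a z = cdot a x}" "v \<in> {z. cdot a z = cdot a x}"
        then show "u + t *s (v - u) \<in> {z. cdot a z = cdot a x}"
          by (simp only: mem_Collect_eq cdot_add cdot_smult cdot_diff) simp
      qed
      show "continuous_on (D \<inter> {z. cdot a z = cdot a x}) g0"
        by (rule continuous_on_subset[OF g0c]) auto
      show "exp (g0 z) = f x" if "z \<in> D \<inter> {z. cdot a z = cdot a x}" for z
        using g0e that by (simp add: f_def)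
    qed (use that in auto)
    define g where "g = (\<lambda>z. g0 (SOME x. x \<in> D \<and> cdot a x = z))"
    have g: "g (cdot a x) = g0 x" if "x \<in> D" for x
    proof -
      have "(SOME y. y \<in> D \<and> cdot a y = cdot a x) \<in> D \<and> cdot a (SOME y. y \<in> D \<and> cdot a y = cdot a x) = cdot a x"
        by (rule someI[of _ x]) (use that in simp)
      then show ?thesis unfolding g_def using g0f that by blast
    qed
    have gc: "continuous_on G g"
    proof (rule continuous_at_imp_continuous_on, rule ballI)
      fix z assume "z \<in> G"
      then obtain x where x: "x \<in> D" "z = cdot a x" by (auto simp: G_def)
      have "continuous_on (T x -` D) (\<lambda>z. g0 (T x z))"
        by (rule continuous_on_compose2[OF g0c Tc]) auto
      then have "continuous_on (T x -` D) g"
        by (rule continuous_on_eq) (use g T in \<open>metis vimageE\<close>)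
      then show "isCont g z"
        using Topen x T continuous_on_eq_continuous_at by (metis vimageI)
    qed
    have ge: "exp (g z) = z - c" if "z \<in> G" for z
      using that g g0e by (auto simp: G_def f_def)
    have "c \<notin> path_image \<gamma>" using \<gamma> c by blast
    then obtain q where q: "path q"
      "pathfinish q - pathstart q = 2 * of_real pi * \<i> * winding_number \<gamma> c"
      "\<And>t. t \<in> {0..1} \<Longrightarrow> \<gamma> t = c + exp (q t)"
      using winding_number_as_continuous_log[OF \<gamma>(1)] by blast
    have \<gamma>G: "\<gamma> t \<in> G" if "t \<in> {0..1}" for t using \<gamma>(2) that by (auto simp: path_image_def)
    \<comment> \<open>Both terms are logarithms of \<gamma> - c along the loop. As \<open>g\<close>
      takes equal values at its ends, so does \<open>q\<close>, and the winding number is 0.\<close>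
    have "q 0 - g (\<gamma> 0) = q 1 - g (\<gamma> 1)"
    proof (rule continuous_exp_constant[of "{0..1::real}" _ 1])
      show "continuous_on {0..1} (\<lambda>t. q t - g (\<gamma> t))"
        using q(1) \<gamma>(1) \<gamma>G
        by (intro continuous_intros continuous_on_compose2[OF gc]) (auto simp: path_def)
      show "exp (q t - g (\<gamma> t)) = 1" if "t \<in> {0..1}" for t
      proof -
        have "exp (q t) = exp (g (\<gamma> t))" using ge[OF \<gamma>G[OF that]] q(3)[OF that] by simp
        then show ?thesis by (simp add: exp_diff)
      qed
    qed auto
    with \<gamma>(3) q(2) show ?thesis by (simp add: pathfinish_def pathstart_def)
  qed
  ultimately show "simply_connected (cdot a ` D)"
    using simply_connected_eq_winding_number_zero[OF \<open>open G\<close>] by (simp add: G_def)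
qed

section \<open>The Koebe estimate for nonvanishing univalent functions\<close>

text \<open>A bridge between the type on which the area of an image is computed and the one on which
  the integral is iterated. The coordinate bijection carries boxes to boxes of equal
  content.\<close>

lemma has_integral_real2_pair:
  fixes f :: "real^2 \<Rightarrow> 'b::banach" and a b :: "real^2"
  assumes "(f has_integral I) (cbox a b)"
  shows "((\<lambda>p. f (vector [fst p, snd p])) has_integral I) (cbox (a $ 1, a $ 2) (b $ 1, b $ 2))"
proof -
  define g where "g = (\<lambda>p::real\<times>real. vector [fst p, snd p] :: real^2)"
  define h where "h = (\<lambda>v::real^2. (v $ 1, v $ 2))"
  have hg: "h (g p) = p" for p by (simp add: g_def h_def)
  have gh: "g (h v) = v" for v by (simp add: g_def h_def vec_eq_iff forall_2)
  have him: "h ` cbox u v = cbox (h u) (h v)" for u v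
  proof
    show "h ` cbox u v \<subseteq> cbox (h u) (h v)" by (auto simp: h_def mem_box_cart)
    show "cbox (h u) (h v) \<subseteq> h ` cbox u v"
    proof
      fix p assume "p \<in> cbox (h u) (h v)"
      then have "g p \<in> cbox u v" by (cases p) (auto simp: h_def g_def mem_box_cart forall_2)
      then show "p \<in> h ` cbox u v" using hg by (metis imageI)
    qed
  qed
  have gim: "g ` cbox u v = cbox (g u) (g v)" for u v
  proof -
    have "g ` h ` cbox (g u) (g v) = cbox (g u) (g v)" by (simp add: image_image gh)
    then show ?thesis by (simp add: him hg)
  qed
  have "((\<lambda>p. f (g p)) has_integral (1 / 1) *\<^sub>R I) (h ` cbox a b)"
  proof (rule has_integral_twiddle[OF _ hg gh _ _ _ _ assms])
    show "continuous (at p) g" for p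
    proof -
      have "linear g" by (rule linearI) (auto simp: g_def vec_eq_iff forall_2)
      then show ?thesis by (simp add: linear_conv_bounded_linear linear_continuous_at)
    qed
    show "\<exists>w z. g ` cbox u v = cbox w z" for u v using gim by blast
    show "\<exists>w z. h ` cbox u v = cbox w z" for u v using him by blast
    show "measure lborel (g ` cbox u v) = 1 * measure lborel (cbox u v)" for u v
    proof -
      obtain u1 u2 v1 v2 where uv: "u = (u1, u2)" "v = (v1, v2)" by fastforce
      have "measure lborel (cbox (g u) (g v)) = (if u1 \<le> v1 \<and> u2 \<le> v2 then (v1 - u1) * (v2 - u2) else 0)"
      proof -
        have "cbox (g u) (g v) \<noteq> {} \<longleftrightarrow> u1 \<le> v1 \<and> u2 \<le> v2"
          by (simp add: interval_ne_empty_cart forall_2 uv g_def)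
        then have "u1 \<le> v1 \<and> u2 \<le> v2 \<and> cbox (g u) (g v) \<noteq> {} \<or>
            \<not> (u1 \<le> v1 \<and> u2 \<le> v2) \<and> cbox (g u) (g v) = {}" by blast
        then show ?thesis
        proof (elim disjE conjE)
          assume "cbox (g u) (g v) \<noteq> {}" "u1 \<le> v1" "u2 \<le> v2"
          then show ?thesis by (simp add: content_cbox_cart UNIV_2 uv g_def)
        next
          assume "cbox (g u) (g v) = {}" "\<not> (u1 \<le> v1 \<and> u2 \<le> v2)"
          then show ?thesis by auto
        qed
      qed
      moreover have "measure lborel (cbox u v) = (if u1 \<le> v1 \<and> u2 \<le> v2 then (v1 - u1) * (v2 - u2) else 0)"
        unfolding uv content_Pair by (auto simp: content_real_if)
      ultimately show ?thesis by (simp add: gim)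
    qed
  qed simp
  then show ?thesis by (simp add: him) (simp add: g_def h_def)
qed

section \<open>Area comparison for injective holomorphic maps on a strip\<close>

definition cvec :: "complex \<Rightarrow> real^2" where "cvec z = vector [Re z, Im z]"
definition vecc :: "real^2 \<Rightarrow> complex" where "vecc v = Complex (v $ 1) (v $ 2)"

lemma cvec_nth [simp]: "cvec z $ 1 = Re z" "cvec z $ 2 = Im z"
  and vecc_sel [simp]: "Re (vecc v) = v $ 1" "Im (vecc v) = v $ 2"
  and cvec_vecc [simp]: "cvec (vecc v) = v" and vecc_cvec [simp]: "vecc (cvec z) = z"
  by (simp_all add: cvec_def vecc_def vec_eq_iff forall_2)

lemma bounded_linear_cvec: "bounded_linear cvec"
proof (rule linear_conv_bounded_linear[THEN iffD1])
  show "linear cvec" by (rule linearI) (auto simp: vec_eq_iff forall_2)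
qed

lemma bounded_linear_vecc: "bounded_linear vecc"
proof (rule linear_conv_bounded_linear[THEN iffD1])
  show "linear vecc" by (rule linearI) (auto simp: complex_eq_iff)
qed

text \<open>The area of the image is the integral of |f'|^2, and |w|^2 \<ge> 2 Re w - 1 because |w -
  1|^2 \<ge> 0. The real part of f' is the vertical derivative of Im f, so its integral over a
  vertical segment depends on the end points only. There Im f is within \<open>C\<close> of the
  height, which yields 2 (2T - 2C) - 2T = 2T - 4C for each segment.\<close>

lemma injective_holomorphic_area_ge:
  assumes "open S" "f holomorphic_on S" "inj_on f S" "a < b" "0 < T"
    and S: "{z. Re z \<in> {a..b} \<and> Im z \<in> {-T..T}} \<subseteq> S"
    and C: "\<And>z. Re z \<in> {a..b} \<Longrightarrow> Im z \<in> {-T..T} \<Longrightarrow> \<bar>Im (f z) - Im z\<bar> \<le> C"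
  defines "E \<equiv> box (cvec (Complex a (-T))) (cvec (Complex b T))"
  shows "(\<lambda>v. cvec (f (vecc v))) ` E \<in> lmeasurable"
    and "(b - a) * (2 * T - 4 * C) \<le> measure lebesgue ((\<lambda>v. cvec (f (vecc v))) ` E)"
proof -
  define g where "g = (\<lambda>v. cvec (f (vecc v)))"
  define K where "K = cbox (cvec (Complex a (-T))) (cvec (Complex b T))"
  have EK: "E \<subseteq> K" unfolding E_def K_def by (rule box_subset_cbox)
  have KS: "vecc v \<in> S" if "v \<in> K" for v
    using that S by (auto simp: K_def mem_box_cart forall_2)
  define w where "w = (\<lambda>v. deriv f (vecc v))"
  define g' where "g' = (\<lambda>v h. cvec (w v * vecc h))"
  have der: "(g has_derivative g' v) (at v within A)" if "v \<in> K" for v A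
  proof -
    have "(f has_field_derivative w v) (at (vecc v))"
      unfolding w_def using assms(1,2) KS[OF that] holomorphic_derivI by blast
    then have "(f has_derivative (\<lambda>h. w v * h)) (at (vecc v))"
      by (simp add: has_field_derivative_def)
    note has_derivative_compose[OF bounded_linear.has_derivative[OF bounded_linear_vecc has_derivative_ident] this]
    from has_derivative_at_withinI[OF bounded_linear.has_derivative[OF bounded_linear_cvec this]]
    show ?thesis unfolding g_def g'_def .
  qed
  have det: "\<bar>det (matrix (g' v))\<bar> = (cmod (w v))\<^sup>2" for v
  proof -
    have v: "vecc (axis 1 1) = 1" "vecc (axis 2 1) = \<i>"
      by (simp_all add: complex_eq_iff axis_def)
    have "det (matrix (g' v)) = (Re (w v))\<^sup>2 + (Im (w v))\<^sup>2"
      by (simp add: det_2 matrix_def g'_def v axis_def power2_eq_square)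
    then show ?thesis by (simp add: cmod_power2)
  qed
  have inj: "inj_on g E"
  proof (rule inj_onI)
    fix u v assume uv: "u \<in> E" "v \<in> E" "g u = g v"
    then have "f (vecc u) = f (vecc v)" unfolding g_def by (metis vecc_cvec)
    then have "vecc u = vecc v" using assms(3) uv EK KS by (meson inj_onD subsetD)
    then show "u = v" by (metis cvec_vecc)
  qed
  have cont: "continuous_on K g"
    using der has_derivative_continuous continuous_on_eq_continuous_within by blast
  have "open (g ` E)"
    by (rule invariance_of_domain[OF continuous_on_subset[OF cont EK] _ inj])
       (unfold E_def, rule open_box)
  moreover have "bounded (g ` E)"
    using compact_continuous_image[OF cont] EK
    by (metis K_def bounded_subset compact_cbox compact_imp_bounded image_mono)
  ultimately have lm: "g ` E \<in> lmeasurable" by (simp add: lmeasurable_open)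
  have int: "((\<lambda>v. (cmod (w v))\<^sup>2) has_integral measure lebesgue (g ` E)) E"
    using has_measure_differentiable_image[of E g g' "measure lebesgue (g ` E)"] lm der inj EK
    unfolding det by (auto simp: E_def)
  define k where "k = (\<lambda>v. 2 * Re (w v) - 1)"
  have df: "continuous_on S (deriv f)"
    using assms(1,2) holomorphic_deriv holomorphic_on_imp_continuous_on by blast
  have kc: "continuous_on K k"
    unfolding k_def w_def
    by (intro continuous_intros continuous_on_compose2[OF df] linear_continuous_on
        bounded_linear_vecc) (use KS in auto)
  have kE: "(k has_integral integral K k) E"
    using integrable_integral[OF integrable_continuous[of _ _ k]] kc
    unfolding K_def E_def has_integral_open_interval by blast
  have le1: "integral K k \<le> measure lebesgue (g ` E)"
  proof (rule has_integral_le[OF kE int])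
    fix v
    have "0 \<le> (Re (w v) - 1)\<^sup>2 + (Im (w v))\<^sup>2" by simp
    also have "\<dots> = (cmod (w v))\<^sup>2 - k v"
      unfolding cmod_power2 k_def by (simp add: power2_eq_square algebra_simps)
    finally show "k v \<le> (cmod (w v))\<^sup>2" by simp
  qed
  define j where "j = (\<lambda>p. 2 * Re (deriv f (Complex (fst p) (snd p))) - 1)"
  have "(k has_integral integral K k) K"
    using integrable_integral[OF integrable_continuous[of _ _ k]] kc unfolding K_def by blast
  from has_integral_real2_pair[OF this[unfolded K_def]]
  have "(j has_integral integral K k) (cbox (a, -T) (b, T))"
    by (simp add: k_def w_def j_def vecc_def K_def)
  then have eq: "integral K k = integral (cbox (a, -T) (b, T)) j" by (simp add: integral_unique)
  have inS: "Complex x y \<in> S" if "x \<in> {a..b}" "y \<in> {-T..T}" for x y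
    using that S by auto
  have jc: "continuous_on (cbox (a, -T) (b, T)) j"
    unfolding j_def
    by (intro continuous_intros continuous_on_compose2[OF df] ) (use inS in auto)
  have "integral (cbox (a, -T) (b, T)) j = integral {a..b} (\<lambda>x. integral {-T..T} (\<lambda>y. j (x, y)))"
    using integral_prod_continuous[OF jc] by simp
  also have "\<dots> \<ge> integral {a..b} (\<lambda>x. 2 * T - 4 * C)"
  proof (rule integral_le)
    show "(\<lambda>x. integral {-T..T} (\<lambda>y. j (x, y))) integrable_on {a..b}"
      using integral_integrable_2dim[OF jc] by simp
    fix x assume x: "x \<in> {a..b}"
    have "((\<lambda>y. j (x, y)) has_integral (2 * Im (f (Complex x T)) - T) - (2 * Im (f (Complex x (-T))) - (-T))) {-T..T}"
    proof (rule fundamental_theorem_of_calculus)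
      fix y assume y: "y \<in> {-T..T}"
      have "(f has_field_derivative deriv f (Complex x y)) (at (Complex x y))"
        using assms(1,2) inS[OF x y] holomorphic_derivI by blast
      moreover have "((\<lambda>y. Complex x y) has_vector_derivative \<i>) (at y within {-T..T})"
        unfolding Complex_eq by (auto intro!: derivative_eq_intros)
      ultimately have "((\<lambda>y. f (Complex x y)) has_vector_derivative \<i> * deriv f (Complex x y)) (at y within {-T..T})"
        using field_vector_diff_chain_within[unfolded o_def] has_field_derivative_at_within by blast
      then have "((\<lambda>y. Im (f (Complex x y))) has_vector_derivative Im (\<i> * deriv f (Complex x y))) (at y within {-T..T})"
        by (rule bounded_linear.has_vector_derivative[OF bounded_linear_Im])
      then have "((\<lambda>y. Im (f (Complex x y))) has_real_derivative Re (deriv f (Complex x y))) (at y within {-T..T})"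
        unfolding has_real_derivative_iff_has_vector_derivative by simp
      from DERIV_diff[OF DERIV_cmult[OF this, of 2] DERIV_ident]
      show "((\<lambda>y. 2 * Im (f (Complex x y)) - y) has_vector_derivative j (x, y)) (at y within {-T..T})"
        unfolding has_real_derivative_iff_has_vector_derivative[symmetric] j_def by simp
    qed (use assms in simp)
    then have "integral {-T..T} (\<lambda>y. j (x, y)) = 2 * Im (f (Complex x T)) - 2 * Im (f (Complex x (-T))) - 2 * T"
      by (simp add: integral_unique)
    moreover have "\<bar>Im (f (Complex x T)) - T\<bar> \<le> C" "\<bar>Im (f (Complex x (-T))) - (-T)\<bar> \<le> C"
      using C[of "Complex x T"] C[of "Complex x (-T)"] x assms(5) by auto
    ultimately show "2 * T - 4 * C \<le> integral {-T..T} (\<lambda>y. j (x, y))" by linarith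
  qed (rule integrable_const_ivl)
  finally have "(b - a) * (2 * T - 4 * C) \<le> integral K k"
    using assms(4) eq by simp
  with le1 lm show "(\<lambda>v. cvec (f (vecc v))) ` E \<in> lmeasurable"
    and "(b - a) * (2 * T - 4 * C) \<le> measure lebesgue ((\<lambda>v. cvec (f (vecc v))) ` E)"
    unfolding g_def by linarith+
qed

text \<open>On the part of the strip of height 2T, \<psi> and its negative have images whose areas are, up to
  a bounded error, at least that of the rectangle of width b - a; the images are disjoint and lie
  in a rectangle of width 2L and height 2T + O(1). Let T tend to infinity.\<close>

lemma strip_width_le:
  assumes "open S" "\<psi> holomorphic_on S" "inj_on \<psi> S" "a < b"
    and S: "{z. Re z \<in> {a..b}} \<subseteq> S"
    and C: "\<And>z. Re z \<in> {a..b} \<Longrightarrow> \<bar>Im (\<psi> z) - Im z\<bar> \<le> C"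
    and L: "\<And>z. Re z \<in> {a..b} \<Longrightarrow> \<bar>Re (\<psi> z)\<bar> \<le> L"
    and disj: "\<And>z w. z \<in> S \<Longrightarrow> w \<in> S \<Longrightarrow> \<psi> z + \<psi> w \<noteq> 0"
  shows "b - a \<le> L"
proof -
  have key: "(b - a) * (T - 2 * C) \<le> L * (T + C)" if T: "T > 0" for T
  proof -
    define E where "E = (\<lambda>a b. box (cvec (Complex a (-T))) (cvec (Complex b T)))"
    \<comment> \<open>Its image is the negative of that of \<psi>, and on the reflected strip it
      again distorts heights by at most \<open>C\<close>, so the same area bound applies.\<close>
    define \<phi> where "\<phi> = (\<lambda>z. - \<psi> (- z))"
    define A where "A = (\<lambda>v. cvec (\<psi> (vecc v))) ` E a b"
    define B where "B = (\<lambda>v. cvec (\<phi> (vecc v))) ` E (-b) (-a)"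
    have A: "A \<in> lmeasurable" "(b - a) * (2 * T - 4 * C) \<le> measure lebesgue A"
      unfolding A_def E_def
      by (rule injective_holomorphic_area_ge[OF assms(1-4) T]; use S C in force)+
    have "open (uminus ` S)" using assms(1) by (rule open_negations)
    moreover have "\<phi> holomorphic_on uminus ` S"
      unfolding \<phi>_def
      by (intro holomorphic_intros holomorphic_on_compose_gen[OF _ assms(2), unfolded o_def]) auto
    moreover have "inj_on \<phi> (uminus ` S)"
      using assms(3) by (auto simp: inj_on_def \<phi>_def)
    moreover have "- b < - a" using assms(4) by simp
    moreover note T
    moreover have "{z. Re z \<in> {-b..-a} \<and> Im z \<in> {-T..T}} \<subseteq> uminus ` S"
    proof
      fix z assume "z \<in> {z. Re z \<in> {-b..-a} \<and> Im z \<in> {-T..T}}"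
      then have "- z \<in> S" using S by auto
      then show "z \<in> uminus ` S" by (metis imageI minus_minus)
    qed
    moreover have "\<bar>Im (\<phi> z) - Im z\<bar> \<le> C" if "Re z \<in> {-b..-a}" for z
      using C[of "-z"] that by (auto simp: \<phi>_def)
    ultimately have B: "B \<in> lmeasurable" "(- a - - b) * (2 * T - 4 * C) \<le> measure lebesgue B"
      using injective_holomorphic_area_ge[of "uminus ` S" \<phi> "-b" "-a" T C]
      unfolding B_def E_def by blast+
    define R where "R = cbox (cvec (Complex (-L) (-(T + C)))) (cvec (Complex L (T + C)))"
    have im: "Re (vecc v) \<in> {a'..b'}" "Im (vecc v) \<in> {-T..T}" if "v \<in> E a' b'" for v a' b'
      using that by (auto simp: E_def mem_box_cart forall_2)
    have "A \<subseteq> R"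
    proof
      fix u assume "u \<in> A"
      then obtain v where v: "v \<in> E a b" "u = cvec (\<psi> (vecc v))" by (auto simp: A_def)
      then show "u \<in> R"
        using C[OF im(1)[OF v(1)]] L[OF im(1)[OF v(1)]] im(2)[OF v(1)]
        unfolding R_def mem_box_cart forall_2 v(2) cvec_nth complex.sel atLeastAtMost_iff by linarith
    qed
    moreover have "B \<subseteq> R"
    proof
      fix u assume "u \<in> B"
      then obtain v where v: "v \<in> E (-b) (-a)" "u = cvec (\<phi> (vecc v))" by (auto simp: B_def)
      have "Re (- vecc v) \<in> {a..b}" using im(1)[OF v(1)] by auto
      from C[OF this] L[OF this] im(2)[OF v(1)] show "u \<in> R"
        unfolding R_def mem_box_cart forall_2 v(2) cvec_nth complex.sel atLeastAtMost_iff \<phi>_def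
          uminus_complex.sel by linarith
    qed
    ultimately have AB: "A \<union> B \<subseteq> R" by blast
    have disjoint: "A \<inter> B = {}"
    proof (rule ccontr)
      assume "A \<inter> B \<noteq> {}"
      then obtain u v where uv: "u \<in> E a b" "v \<in> E (-b) (-a)" "cvec (\<psi> (vecc u)) = cvec (\<phi> (vecc v))"
        by (auto simp: A_def B_def)
      then have "\<psi> (vecc u) = \<phi> (vecc v)" by (metis vecc_cvec)
      then have "\<psi> (vecc u) + \<psi> (- vecc v) = 0" by (simp add: \<phi>_def)
      moreover have "vecc u \<in> S" using im(1)[OF uv(1)] S by blast
      moreover have "- vecc v \<in> S" using im(1)[OF uv(2)] S by (auto simp: subset_iff)
      ultimately show False using disj by blast
    qed
    have ne: "R \<noteq> {}"
    proof -
      have "E a b \<noteq> {}" using assms(4) T by (simp add: E_def interval_ne_empty_cart forall_2)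
      then show ?thesis using AB by (auto simp: A_def)
    qed
    have "measure lebesgue A + measure lebesgue B = measure lebesgue (A \<union> B)"
      using measure_Un2[OF A(1) B(1)] disjoint by (metis Diff_triv inf_commute)
    also have "\<dots> \<le> measure lebesgue R"
      using A(1) B(1) AB by (intro measure_mono_fmeasurable) (auto simp: R_def)
    also have "\<dots> = 2 * L * (2 * (T + C))"
      using ne content_cbox_cart[of "cvec (Complex (-L) (-(T + C)))" "cvec (Complex L (T + C))"]
      unfolding R_def by (simp add: UNIV_2)
    finally show ?thesis using A(2) B(2) by (simp add: algebra_simps)
  qed
  show ?thesis
  proof (rule ccontr)
    assume "\<not> b - a \<le> L"
    then have d: "b - a - L > 0" by simp
    \<comment> \<open>Large enough for the surplus width times \<open>T\<close> to exceed the terms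
      of \<open>key\<close> that are free of \<open>T\<close>.\<close>
    define T where "T = (\<bar>2 * (b - a) * C + L * C\<bar> + 1) / (b - a - L)"
    have T: "T > 0" unfolding T_def using d by (intro divide_pos_pos) auto
    have "(b - a - L) * T = \<bar>2 * (b - a) * C + L * C\<bar> + 1" using d by (simp add: T_def)
    moreover have "(b - a - L) * T \<le> 2 * (b - a) * C + L * C"
      using key[OF T] by (simp add: algebra_simps)
    ultimately show False by linarith
  qed
qed

lemma cball_bounded_continuous:
  fixes f :: "complex \<Rightarrow> complex"
  assumes "continuous_on (ball 0 1) f" "s < 1"
  obtains C where "\<And>z. cmod z \<le> s \<Longrightarrow> cmod (f z) \<le> C"
proof -
  have "compact (f ` cball 0 s)"
    using assms by (intro compact_continuous_image continuous_on_subset[OF assms(1)]) auto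
  then obtain C where "\<forall>x\<in>f ` cball 0 s. norm x \<le> C"
    using compact_imp_bounded bounded_iff by metis
  with that[of C] show thesis by simp
qed

lemma holomorphic_log_ball:
  assumes "f holomorphic_on ball 0 1" "\<And>z. z \<in> ball 0 1 \<Longrightarrow> f z \<noteq> 0"
  obtains l where "l holomorphic_on ball 0 1" "\<And>z. z \<in> ball 0 1 \<Longrightarrow> f z = exp (l z)"
proof -
  have "simply_connected (ball (0::complex) 1)" by (simp add: convex_imp_simply_connected)
  then show thesis
    using simply_connected_eq_holomorphic_log[of "ball (0::complex) 1"] assms that by auto
qed

section \<open>Univalent maps of the disc without reciprocal pairs of values\<close>

text \<open>In logarithmic coordinates the annulus r \<le> |z| \<le> s becomes a strip of width ln s
  - ln r, and \<phi> becomes \<open>\<psi>\<close>, a periodic perturbation of the identity. On the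
  annulus |\<phi>| \<ge> \<rho>, since smaller values are already taken inside radius
  \<open>r\<close>, and |\<phi>| \<le> 1/\<rho>, since a larger value would have its reciprocal
  among them. So the image of the strip has |Re| \<le> - ln \<rho>, and the absence of reciprocals
  makes it disjoint from its negative.\<close>

lemma reciprocal_free_ball_image:
  assumes hol: "\<phi> holomorphic_on ball 0 1" and inj: "inj_on \<phi> (ball 0 1)" and "\<phi> 0 = 0"
    and rec: "\<And>z w. z \<in> ball 0 1 \<Longrightarrow> w \<in> ball 0 1 \<Longrightarrow> \<phi> z * \<phi> w \<noteq> 1"
    and r: "0 < r" "r < s" "s < 1" and \<rho>: "0 < \<rho>" "ball 0 \<rho> \<subseteq> \<phi> ` ball 0 r"
  shows "s * \<rho> \<le> r"
proof -
  obtain u where u: "u holomorphic_on ball 0 1" "\<And>z. norm z < 1 \<Longrightarrow> \<phi> z = z * u z" "deriv \<phi> 0 = u 0"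
    using Schwarz3[OF hol \<open>\<phi> 0 = 0\<close>] by blast
  have "deriv \<phi> 0 \<noteq> 0"
    using holomorphic_injective_imp_regular[OF hol open_ball inj, of 0] by simp
  have "u z \<noteq> 0" if "z \<in> ball 0 1" for z
  proof (cases "z = 0")
    case True
    then show ?thesis using u(3) \<open>deriv \<phi> 0 \<noteq> 0\<close> by simp
  next
    case False
    have "\<phi> z \<noteq> \<phi> 0" using inj_onD[OF inj, of z 0] False that by auto
    then show ?thesis using u(2)[of z] that \<open>\<phi> 0 = 0\<close> by auto
  qed
  then obtain \<kappa> where \<kappa>: "\<kappa> holomorphic_on ball 0 1" "\<And>z. z \<in> ball 0 1 \<Longrightarrow> u z = exp (\<kappa> z)"
    using holomorphic_log_ball[OF u(1)] by metis
  define S where "S = {\<zeta>. Re \<zeta> < 0}"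
  define \<psi> where "\<psi> = (\<lambda>\<zeta>. \<zeta> + \<kappa> (exp \<zeta>))"
  have expS: "exp \<zeta> \<in> ball 0 1" if "\<zeta> \<in> S" for \<zeta> using that by (simp add: S_def)
  have exp\<psi>: "exp (\<psi> \<zeta>) = \<phi> (exp \<zeta>)" if "\<zeta> \<in> S" for \<zeta>
    using u(2)[of "exp \<zeta>"] \<kappa>(2)[OF expS[OF that]] expS[OF that] by (simp add: \<psi>_def exp_add)
  obtain C where C: "\<And>z. cmod z \<le> s \<Longrightarrow> cmod (\<kappa> z) \<le> C"
    using cball_bounded_continuous[OF holomorphic_on_imp_continuous_on[OF \<kappa>(1)] r(3)] by blast
  have strip: "r \<le> cmod (exp \<zeta>)" "cmod (exp \<zeta>) \<le> s" "\<zeta> \<in> S" if "Re \<zeta> \<in> {ln r..ln s}" for \<zeta>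
  proof -
    have "ln r \<le> Re \<zeta>" "Re \<zeta> \<le> ln s" using that by auto
    then show "r \<le> cmod (exp \<zeta>)" "cmod (exp \<zeta>) \<le> s"
      using r exp_le_cancel_iff[of "ln r" "Re \<zeta>"] exp_le_cancel_iff[of "Re \<zeta>" "ln s"]
      by simp_all
    have "ln s < 0" using r by simp
    with \<open>Re \<zeta> \<le> ln s\<close> show "\<zeta> \<in> S" by (simp add: S_def)
  qed
  have ge: "\<rho> \<le> cmod (\<phi> z)" if "r \<le> cmod z" "z \<in> ball 0 1" for z
  proof (rule ccontr)
    assume "\<not> \<rho> \<le> cmod (\<phi> z)"
    then have "\<phi> z \<in> ball 0 \<rho>" by simp
    then obtain z' where z': "z' \<in> ball 0 r" "\<phi> z = \<phi> z'" using \<rho>(2) by blast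
    then have "z = z'" using inj_onD[OF inj] that r by simp
    with z' that show False by simp
  qed
  have le: "cmod (\<phi> z) \<le> 1 / \<rho>" if "r \<le> cmod z" "z \<in> ball 0 1" for z
  proof (rule ccontr)
    assume gt: "\<not> cmod (\<phi> z) \<le> 1 / \<rho>"
    moreover have "0 < 1 / \<rho>" using \<rho> by simp
    ultimately have pos: "0 < cmod (\<phi> z)" by linarith
    have "1 / cmod (\<phi> z) < \<rho>" using gt \<rho>(1) pos by (simp add: field_simps)
    then have "inverse (\<phi> z) \<in> ball 0 \<rho>" by (simp add: norm_inverse inverse_eq_divide norm_divide)
    then obtain z' where z': "z' \<in> ball 0 r" "inverse (\<phi> z) = \<phi> z'" using \<rho>(2) by blast
    then have "\<phi> z * \<phi> z' = 1" using pos by (metis right_inverse zero_less_norm_iff)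
    then show False using rec[of z z'] that z' r by simp
  qed
  have "ln s - ln r \<le> - ln \<rho>"
  proof (rule strip_width_le[of S \<psi> "ln r" "ln s" C])
    show "open S" unfolding S_def by (rule open_halfspace_Re_lt)
    show "\<psi> holomorphic_on S"
      unfolding \<psi>_def
      by (intro holomorphic_intros holomorphic_on_compose_gen[OF _ \<kappa>(1), unfolded o_def])
         (use expS in auto)
    show "inj_on \<psi> S"
    proof (rule inj_onI)
      fix x y assume xy: "x \<in> S" "y \<in> S" "\<psi> x = \<psi> y"
      then have "\<phi> (exp x) = \<phi> (exp y)" using exp\<psi> by metis
      then have "exp x = exp y" using inj_onD[OF inj] expS xy by blast
      with xy(3) show "x = y" by (simp add: \<psi>_def)
    qed
    show "ln r < ln s" using r by simp
    show "{z. Re z \<in> {ln r..ln s}} \<subseteq> S" using strip by blast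
    show "\<bar>Im (\<psi> z) - Im z\<bar> \<le> C" if "Re z \<in> {ln r..ln s}" for z
      using C[OF strip(2)[OF that]] abs_Im_le_cmod[of "\<kappa> (exp z)"] by (simp add: \<psi>_def)
    show "\<bar>Re (\<psi> z)\<bar> \<le> - ln \<rho>" if z: "Re z \<in> {ln r..ln s}" for z
    proof -
      have "exp (Re (\<psi> z)) = cmod (\<phi> (exp z))" using exp\<psi>[OF strip(3)[OF z]] by (metis norm_exp_eq_Re)
      then have "\<rho> \<le> exp (Re (\<psi> z))" "exp (Re (\<psi> z)) \<le> 1 / \<rho>"
        using ge le strip[OF z] expS by metis+
      then have "ln \<rho> \<le> Re (\<psi> z)" "Re (\<psi> z) \<le> ln (1 / \<rho>)"
        using \<rho>(1) ln_le_cancel_iff[of \<rho> "exp (Re (\<psi> z))"] by (simp_all add: ln_ge_iff)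
      moreover have "ln (1 / \<rho>) = - ln \<rho>" using \<rho>(1) by (simp add: ln_div)
      ultimately show ?thesis by linarith
    qed
    show "\<psi> z + \<psi> w \<noteq> 0" if "z \<in> S" "w \<in> S" for z w
    proof
      assume "\<psi> z + \<psi> w = 0"
      then have "exp (\<psi> z) * exp (\<psi> w) = 1" by (metis exp_add exp_zero)
      then show False using rec expS exp\<psi> that by metis
    qed
  qed
  then have "ln s + ln \<rho> \<le> ln r" by linarith
  then have "ln (s * \<rho>) \<le> ln r" using r \<rho>(1) by (simp add: ln_mult)
  then show ?thesis using r \<rho>(1) by (subst (asm) ln_le_cancel_iff) auto
qed

text \<open>If |\<phi>'(0)| exceeded some c > 1, the image of a small disc of radius r would contain
  the disc of radius c r. The preceding bound then gives s c \<le> 1 for each admissible s < 1,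
  which fails for s close to 1.\<close>

lemma reciprocal_free_deriv_le_1:
  assumes hol: "\<phi> holomorphic_on ball 0 1" and inj: "inj_on \<phi> (ball 0 1)" and "\<phi> 0 = 0"
    and rec: "\<And>z w. z \<in> ball 0 1 \<Longrightarrow> w \<in> ball 0 1 \<Longrightarrow> \<phi> z * \<phi> w \<noteq> 1"
  shows "cmod (deriv \<phi> 0) \<le> 1"
proof (rule ccontr)
  assume "\<not> cmod (deriv \<phi> 0) \<le> 1"
  then obtain c where c: "1 < c" "c < cmod (deriv \<phi> 0)" using dense by (metis not_le)
  obtain u where u: "u holomorphic_on ball 0 1" "\<And>z. norm z < 1 \<Longrightarrow> \<phi> z = z * u z" "deriv \<phi> 0 = u 0"
    using Schwarz3[OF hol \<open>\<phi> 0 = 0\<close>] by blast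
  have "open (ball 0 1 \<inter> (\<lambda>z. cmod (u z)) -` {c<..})"
    by (intro continuous_open_preimage continuous_on_norm holomorphic_on_imp_continuous_on u) auto
  moreover have "0 \<in> ball 0 1 \<inter> (\<lambda>z. cmod (u z)) -` {c<..}" using c u(3) by simp
  ultimately obtain r where r: "r > 0" "cball 0 r \<subseteq> ball 0 1 \<inter> (\<lambda>z. cmod (u z)) -` {c<..}"
    using open_contains_cball by blast
  have "of_real r \<in> cball (0::complex) r" using r(1) by simp
  then have "of_real r \<in> ball (0::complex) 1" using r(2) by blast
  then have r1: "r < 1" using r(1) by simp
  have "ball (\<phi> 0) (c * r) \<subseteq> \<phi> ` ball 0 r"
  proof (rule ball_subset_open_map_image)
    show "continuous_on (closure (ball 0 r)) \<phi>"
      by (rule continuous_on_subset[OF holomorphic_on_imp_continuous_on[OF hol]])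
         (use r r1 in \<open>auto simp: closure_ball\<close>)
    show "open (\<phi> ` interior (ball 0 r))"
    proof -
      have "ball (0::complex) r \<subseteq> ball 0 1" using r1 by auto
      then show ?thesis
        using open_mapping_thm3[of \<phi> "ball 0 r"] hol inj
        by (metis holomorphic_on_subset inj_on_subset interior_open open_ball)
    qed
    show "c * r \<le> cmod (\<phi> z - \<phi> 0)" if "z \<in> frontier (ball 0 r)" for z
    proof -
      have z: "cmod z = r" using that r(1) by (simp add: frontier_ball)
      then have "c < cmod (u z)" using r(2) by auto
      then show ?thesis using u(2)[of z] z r(1) r1 \<open>\<phi> 0 = 0\<close>
        by (simp add: norm_mult mult.commute)
    qed
  qed (use c r in auto)
  then have sub: "ball 0 (c * r) \<subseteq> \<phi> ` ball 0 r" using \<open>\<phi> 0 = 0\<close> by simp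
  \<comment> \<open>The bound \<open>1 / c\<close> is there to force
    \<open>s * c > 1\<close>.\<close>
  have "max r (1 / c) < 1" using r1 c by simp
  then obtain s where s: "max r (1 / c) < s" "s < 1" using dense by blast
  have "s * (c * r) \<le> r"
    by (rule reciprocal_free_ball_image[OF hol inj \<open>\<phi> 0 = 0\<close> rec r(1) _ s(2) _ sub]) (use s c r in auto)
  then have "s * c \<le> 1" using r(1) by (simp add: mult.assoc[symmetric])
  moreover have "1 < s * c" using s(1) c by (simp add: field_simps)
  ultimately show False by simp
qed

section \<open>Growth of nonvanishing univalent functions\<close>

text \<open>Injectivity of g = h^2 makes the image of h disjoint from its negative. The Moebius map
  sending \<open>a\<close> to 0 and \<open>- a\<close> to infinity conjugates negation to inversion,
  so \<phi> has no two values with product 1. The 4 comes from the two factors 2 in g'(0) = 2 a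
  h'(0) and \<phi>'(0) = h'(0) / (2 a).\<close>

lemma koebe_omitted_zero:
  assumes g: "g holomorphic_on ball 0 1" and inj: "inj_on g (ball 0 1)"
    and nz: "\<And>z. z \<in> ball 0 1 \<Longrightarrow> g z \<noteq> 0"
  shows "cmod (deriv g 0) \<le> 4 * cmod (g 0)"
proof -
  obtain l where l: "l holomorphic_on ball 0 1" "\<And>z. z \<in> ball 0 1 \<Longrightarrow> g z = exp (l z)"
    using holomorphic_log_ball[OF g nz] by blast
  define h where "h = (\<lambda>z. exp (l z / 2))"
  have hh: "h holomorphic_on ball 0 1" unfolding h_def by (intro holomorphic_intros l) auto
  have h2: "(h z)\<^sup>2 = g z" if "z \<in> ball 0 1" for z
    using l(2)[OF that] by (simp add: h_def flip: exp_double)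
  have hnz: "h z \<noteq> 0" for z by (simp add: h_def)
  have hneg: "h z + h w \<noteq> 0" if "z \<in> ball 0 1" "w \<in> ball 0 1" for z w
  proof
    assume s: "h z + h w = 0"
    then have "h z = - h w" by (simp add: eq_neg_iff_add_eq_0)
    then have "g z = g w" using h2[OF that(1)] h2[OF that(2)] by simp
    then have "z = w" using inj_onD[OF inj] that by blast
    with s hnz[of w] show False by simp
  qed
  define a where "a = h 0"
  define \<phi> where "\<phi> = (\<lambda>z. (h z - a) / (h z + a))"
  have den: "h z + a \<noteq> 0" if "z \<in> ball 0 1" for z using hneg[OF that, of 0] by (simp add: a_def)
  have "cmod (deriv \<phi> 0) \<le> 1"
  proof (rule reciprocal_free_deriv_le_1)
    show "\<phi> holomorphic_on ball 0 1" unfolding \<phi>_def using den by (intro holomorphic_intros hh) auto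
    show "\<phi> 0 = 0" by (simp add: \<phi>_def a_def)
    show "inj_on \<phi> (ball 0 1)"
    proof (rule inj_onI)
      fix z w assume zw: "z \<in> ball 0 1" "w \<in> ball 0 1" "\<phi> z = \<phi> w"
      then have "(h z - a) * (h w + a) = (h w - a) * (h z + a)"
        using den by (simp add: \<phi>_def frac_eq_eq)
      then have "2 * a * (h z - h w) = 0" by algebra
      then have "h z = h w" using hnz[of 0] by (simp add: a_def)
      then have "g z = g w" using h2[OF zw(1)] h2[OF zw(2)] by simp
      then show "z = w" using inj_onD[OF inj] zw by blast
    qed
    show "\<phi> z * \<phi> w \<noteq> 1" if zw: "z \<in> ball 0 1" "w \<in> ball 0 1" for z w
    proof
      assume "\<phi> z * \<phi> w = 1"
      then have "(h z - a) * (h w - a) = (h z + a) * (h w + a)"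
        using den[OF zw(1)] den[OF zw(2)] by (simp add: \<phi>_def field_simps)
      then have "2 * a * (h z + h w) = 0" by algebra
      then show False using hneg[OF zw] hnz[of 0] by (simp add: a_def)
    qed
  qed
  moreover have "deriv \<phi> 0 = deriv g 0 / (4 * g 0)"
  proof -
    have h': "(h has_field_derivative deriv h 0) (at 0)"
      using hh by (intro holomorphic_derivI[of _ "ball 0 1"]) auto
    from DERIV_mult[OF h' h']
    have "((\<lambda>z. h z * h z) has_field_derivative 2 * h 0 * deriv h 0) (at 0)"
      by (simp add: algebra_simps)
    then have "(g has_field_derivative 2 * h 0 * deriv h 0) (at 0)"
      by (rule has_field_derivative_transform_within_open[where S = "ball 0 1"])
         (use h2 in \<open>auto simp: power2_eq_square\<close>)
    then have "deriv g 0 = 2 * a * deriv h 0" by (simp add: DERIV_imp_deriv a_def)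
    moreover have "(\<phi> has_field_derivative ((deriv h 0 - 0) * (h 0 + a) - (h 0 - a) * (deriv h 0 + 0))
        / ((h 0 + a) * (h 0 + a))) (at 0)"
      unfolding \<phi>_def using den[of 0] by (intro DERIV_divide DERIV_diff DERIV_add h' DERIV_const) simp
    then have "(\<phi> has_field_derivative deriv h 0 / (2 * a)) (at 0)"
      using hnz[of 0] by (simp add: a_def)
    then have "deriv \<phi> 0 = deriv h 0 / (2 * a)" by (rule DERIV_imp_deriv)
    moreover have "g 0 = a\<^sup>2" using h2[of 0] by (simp add: a_def)
    ultimately show ?thesis using hnz[of 0] by (simp add: a_def power2_eq_square)
  qed
  ultimately show ?thesis using nz[of 0] by (simp add: norm_divide norm_mult divide_le_eq)
qed

lemma koebe_omitted_zero_at: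
  assumes g: "g holomorphic_on ball 0 1" and inj: "inj_on g (ball 0 1)"
    and nz: "\<And>z. z \<in> ball 0 1 \<Longrightarrow> g z \<noteq> 0" and \<zeta>: "cmod \<zeta> < 1"
  shows "cmod (deriv g \<zeta>) * (1 - (cmod \<zeta>)\<^sup>2) \<le> 4 * cmod (g \<zeta>)"
proof -
  \<comment> \<open>The disc automorphism with \<open>M 0 = \<zeta>\<close>; its derivative at 0 is
    the factor 1 - |\<zeta>|^2.\<close>
  define M where "M = Moebius_function 0 (-\<zeta>)"
  have M: "M holomorphic_on ball 0 1" "\<And>z. z \<in> ball 0 1 \<Longrightarrow> M z \<in> ball 0 1"
    using Moebius_function_holomorphic[of "-\<zeta>"] Moebius_function_norm_lt_1[of "-\<zeta>"] \<zeta>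
    by (simp_all add: M_def)
  have M0: "M 0 = \<zeta>" by (simp add: M_def Moebius_function_simple)
  have "cmod (deriv (\<lambda>w. g (M w)) 0) \<le> 4 * cmod (g (M 0))"
  proof (rule koebe_omitted_zero)
    show "(\<lambda>w. g (M w)) holomorphic_on ball 0 1"
      using holomorphic_on_compose_gen[OF M(1) g] M(2) by (auto simp: o_def image_subset_iff)
    show "inj_on (\<lambda>w. g (M w)) (ball 0 1)"
    proof (rule inj_onI)
      fix x y assume xy: "x \<in> ball 0 1" "y \<in> ball 0 1" "g (M x) = g (M y)"
      then have "M x = M y" using inj_onD[OF inj] M(2) by blast
      then show "x = y"
        using Moebius_function_compose[of \<zeta> "-\<zeta>"] \<zeta> xy unfolding M_def
        by (metis add.inverse_inverse dist_0_norm mem_ball norm_minus_cancel)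
    qed
    show "g (M z) \<noteq> 0" if "z \<in> ball 0 1" for z using nz M(2) that by blast
  qed
  moreover have "deriv (\<lambda>w. g (M w)) 0 = deriv g \<zeta> * (1 - of_real ((cmod \<zeta>)\<^sup>2))"
  proof -
    have Meq: "M = (\<lambda>z. (z + \<zeta>) / (1 + cnj \<zeta> * z))"
      by (simp add: M_def Moebius_function_simple fun_eq_iff)
    from DERIV_divide[OF DERIV_add[OF DERIV_ident DERIV_const] DERIV_add[OF DERIV_const DERIV_cmult[OF DERIV_ident]],
        of 1 "cnj \<zeta>" 0 \<zeta> UNIV]
    have "(M has_field_derivative 1 - \<zeta> * cnj \<zeta>) (at 0)"
      unfolding Meq by simp
    moreover have "(g has_field_derivative deriv g \<zeta>) (at (M 0))"
      unfolding M0 using g \<zeta> by (intro holomorphic_derivI[of _ "ball 0 1"]) auto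
    ultimately have "((\<lambda>w. g (M w)) has_field_derivative deriv g \<zeta> * (1 - \<zeta> * cnj \<zeta>)) (at 0)"
      by (rule DERIV_chain2[rotated])
    then show ?thesis unfolding complex_norm_square by (rule DERIV_imp_deriv)
  qed
  moreover have "cmod (1 - of_real ((cmod \<zeta>)\<^sup>2)) = 1 - (cmod \<zeta>)\<^sup>2"
  proof -
    have "(cmod \<zeta>)\<^sup>2 \<le> 1" using \<zeta> by (simp add: power_le_one)
    moreover have "cmod (1 - of_real ((cmod \<zeta>)\<^sup>2)) = \<bar>1 - (cmod \<zeta>)\<^sup>2\<bar>"
      by (metis norm_of_real of_real_1 of_real_diff)
    ultimately show ?thesis by simp
  qed
  ultimately show ?thesis by (simp add: M0 norm_mult)
qed

text \<open>With l = log g the pointwise estimate reads |l'| (1 - |\<zeta>|^2) \<le> 4. Hence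
  \<open>m\<close>, the sum of log |g| and four times the hyperbolic distance from 0, does not
  decrease along the radius to \<open>z\<close>.\<close>

lemma univalent_omitted_zero_growth:
  assumes g: "g holomorphic_on ball 0 1" and inj: "inj_on g (ball 0 1)"
    and nz: "\<And>z. z \<in> ball 0 1 \<Longrightarrow> g z \<noteq> 0" and z: "cmod z < 1"
  shows "1 / 4 * ln (cmod (g 0) / cmod (g z)) \<le> artanh (cmod z)"
proof -
  obtain l where l: "l holomorphic_on ball 0 1" "\<And>z. z \<in> ball 0 1 \<Longrightarrow> g z = exp (l z)"
    using holomorphic_log_ball[OF g nz] by blast
  have l': "cmod (deriv l \<zeta>) * (1 - (cmod \<zeta>)\<^sup>2) \<le> 4" if \<zeta>: "cmod \<zeta> < 1" for \<zeta>
  proof -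
    have "(l has_field_derivative deriv l \<zeta>) (at \<zeta>)"
      using l(1) \<zeta> by (intro holomorphic_derivI[of _ "ball 0 1"]) auto
    then have "((\<lambda>z. exp (l z)) has_field_derivative exp (l \<zeta>) * deriv l \<zeta>) (at \<zeta>)"
      by (rule DERIV_fun_exp)
    then have "(g has_field_derivative exp (l \<zeta>) * deriv l \<zeta>) (at \<zeta>)"
      by (rule has_field_derivative_transform_within_open[where S = "ball 0 1"]) (use l \<zeta> in auto)
    then have "deriv g \<zeta> = g \<zeta> * deriv l \<zeta>" using l(2)[of \<zeta>] \<zeta> by (simp add: DERIV_imp_deriv)
    with koebe_omitted_zero_at[OF g inj nz \<zeta>]
    have "cmod (g \<zeta>) * (cmod (deriv l \<zeta>) * (1 - (cmod \<zeta>)\<^sup>2)) \<le> cmod (g \<zeta>) * 4"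
      by (simp add: norm_mult algebra_simps)
    moreover have "0 < cmod (g \<zeta>)" using nz \<zeta> by simp
    ultimately show ?thesis by (rule mult_left_le_imp_le)
  qed
  define m where "m = (\<lambda>t. Re (l (of_real t * z)) + 4 * artanh (t * cmod z))"
  have "m 0 \<le> m 1"
  proof (rule DERIV_nonneg_imp_nondecreasing[of 0 1 m])
    fix t :: real assume t: "0 \<le> t" "t \<le> 1"
    have tz: "cmod (of_real t * z) = t * cmod z" using t by (simp add: norm_mult)
    have tz1: "t * cmod z < 1" using t z by (meson mult_left_le_one_le norm_ge_zero le_less_trans)
    have "(l has_field_derivative deriv l (of_real t * z)) (at (of_real t * z))"
      using l(1) tz tz1 by (intro holomorphic_derivI[of _ "ball 0 1"]) auto
    moreover have "((\<lambda>t. of_real t * z) has_vector_derivative z) (at t)"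
      by (auto intro!: derivative_eq_intros)
    ultimately have "((\<lambda>t. l (of_real t * z)) has_vector_derivative z * deriv l (of_real t * z)) (at t)"
      using field_vector_diff_chain_at[unfolded o_def] by blast
    then have "((\<lambda>t. Re (l (of_real t * z))) has_vector_derivative Re (z * deriv l (of_real t * z))) (at t)"
      by (rule bounded_linear.has_vector_derivative[OF bounded_linear_Re])
    then have d1: "((\<lambda>t. Re (l (of_real t * z))) has_real_derivative Re (z * deriv l (of_real t * z))) (at t)"
      by (simp add: has_real_derivative_iff_has_vector_derivative)
    have "((\<lambda>t. t * cmod z) has_real_derivative cmod z) (at t)"
      by (auto intro!: derivative_eq_intros)
    from DERIV_chain2[OF artanh_real_has_field_derivative this]
    have d2: "((\<lambda>t. artanh (t * cmod z)) has_real_derivative cmod z / (1 - (t * cmod z)\<^sup>2)) (at t)"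
      using tz1 t by (simp add: abs_mult)
    have sq: "(t * cmod z)\<^sup>2 < 1" using tz1 t by (simp add: power_less_one_iff)
    have "\<bar>Re (z * deriv l (of_real t * z))\<bar> \<le> cmod z * cmod (deriv l (of_real t * z))"
      by (metis abs_Re_le_cmod norm_mult)
    also have "\<dots> \<le> cmod z * (4 / (1 - (t * cmod z)\<^sup>2))"
      using l'[of "of_real t * z"] tz tz1 sq by (intro mult_left_mono) (simp_all add: le_divide_eq)
    also have "\<dots> = 4 * (cmod z / (1 - (t * cmod z)\<^sup>2))" by simp
    finally have "0 \<le> Re (z * deriv l (of_real t * z)) + 4 * (cmod z / (1 - (t * cmod z)\<^sup>2))"
      by linarith
    moreover have "(m has_real_derivative Re (z * deriv l (of_real t * z)) + 4 * (cmod z / (1 - (t * cmod z)\<^sup>2))) (at t)"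
      unfolding m_def by (intro DERIV_add d1 DERIV_cmult d2)
    ultimately show "\<exists>y. (m has_real_derivative y) (at t) \<and> 0 \<le> y" by blast
  qed simp
  then have "Re (l 0) - Re (l z) \<le> 4 * artanh (cmod z)" by (simp add: m_def)
  moreover have "ln (cmod (g 0) / cmod (g z)) = Re (l 0) - Re (l z)"
    using l(2)[of 0] l(2)[of z] z by (simp add: ln_div)
  ultimately show ?thesis by simp
qed

text \<open>\<open>F\<close> is the Riemann map normalised at \<open>z\<close>. Its inverse
  \<open>h\<close> is univalent on the disc, omits 0 because \<open>G\<close> does, and takes 0 to
  \<open>z\<close> and \<open>F w\<close> to \<open>w\<close>, so the growth bound applies at
  \<open>F w\<close>.\<close>

proposition simply_connected_artanh_lower_bound:
  assumes G: "open G" "simply_connected G" "0 \<notin> G" and zw: "z \<in> G" "w \<in> G"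
  obtains F where "F holomorphic_on G" "F ` G \<subseteq> ball 0 1" "F z = 0"
    "1 / 4 * ln (cmod z / cmod w) \<le> artanh (cmod (F w))"
proof -
  obtain f g where fg: "f holomorphic_on G" "g holomorphic_on ball 0 1"
    "\<And>z. z \<in> G \<Longrightarrow> f z \<in> ball 0 1 \<and> g (f z) = z"
    "\<And>z. z \<in> ball 0 1 \<Longrightarrow> g z \<in> G \<and> f (g z) = z"
    using Riemann_mapping_theorem[of G] G zw by blast
  define a where "a = f z"
  have a: "cmod a < 1" using fg(3)[OF zw(1)] by (simp add: a_def)
  define M where "M = Moebius_function 0 a"
  define N where "N = Moebius_function 0 (-a)"
  have M: "M holomorphic_on ball 0 1" "\<And>z. z \<in> ball 0 1 \<Longrightarrow> M z \<in> ball 0 1"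
    using Moebius_function_holomorphic[of a] Moebius_function_norm_lt_1[of a] a by (simp_all add: M_def)
  have N: "N holomorphic_on ball 0 1" "\<And>z. z \<in> ball 0 1 \<Longrightarrow> N z \<in> ball 0 1"
    using Moebius_function_holomorphic[of "-a"] Moebius_function_norm_lt_1[of "-a"] a
    by (simp_all add: N_def)
  have NM: "N (M x) = x" and MN: "M (N x) = x" if "x \<in> ball 0 1" for x
    using Moebius_function_compose[of "-a" a x] Moebius_function_compose[of a "-a" x] a that
    by (simp_all add: M_def N_def)
  define F where "F = (\<lambda>z. M (f z))"
  define h where "h = (\<lambda>x. g (N x))"
  have "1 / 4 * ln (cmod (h 0) / cmod (h (F w))) \<le> artanh (cmod (F w))"
  proof (rule univalent_omitted_zero_growth)
    show "h holomorphic_on ball 0 1"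
      unfolding h_def using holomorphic_on_compose_gen[OF N(1) fg(2)] N(2) by (auto simp: o_def image_subset_iff)
    show "inj_on h (ball 0 1)"
    proof (rule inj_onI)
      fix x y assume "x \<in> ball 0 1" "y \<in> ball 0 1" "h x = h y"
      then show "x = y" unfolding h_def using fg(4) N(2) MN by metis
    qed
    show "h x \<noteq> 0" if "x \<in> ball 0 1" for x using fg(4) N(2) that G(3) unfolding h_def by metis
    show "cmod (F w) < 1" using M(2) fg(3)[OF zw(2)] by (simp add: F_def)
  qed
  moreover have "h 0 = z" using fg(3)[OF zw(1)] by (simp add: h_def N_def Moebius_function_simple a_def)
  moreover have "h (F w) = w" using fg(3)[OF zw(2)] by (simp add: h_def F_def NM)
  moreover have "F holomorphic_on G"
    unfolding F_def using holomorphic_on_compose_gen[OF fg(1) M(1)] fg(3) by (auto simp: o_def image_subset_iff)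
  moreover have "F ` G \<subseteq> ball 0 1" using fg(3) M(2) by (auto simp: F_def)
  moreover have "F z = 0" by (simp add: F_def M_def a_def Moebius_function_simple)
  ultimately show thesis using that by metis
qed

section \<open>Comparison of the Bergman and Caratheodory distances\<close>

text \<open>Only gauge integrability is assumed. If the right-hand side is infinite there is nothing
  to show; otherwise \<open>f\<close> is absolutely integrable on \<Omega> and both notions of
  integral agree.\<close>

lemma norm_has_integral_le_nn_integral:
  fixes f :: "'a::euclidean_space \<Rightarrow> 'b::euclidean_space"
  assumes "(f has_integral I) \<Omega>"
  shows "ennreal (norm I) \<le> (\<integral>\<^sup>+x\<in>\<Omega>. ennreal (norm (f x)) \<partial>lborel)"
proof -
  define h where "h = (\<lambda>x. indicator \<Omega> x *\<^sub>R f x)"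
  have h: "h \<in> borel_measurable lebesgue"
    unfolding h_def by (rule has_integral_implies_lebesgue_measurable[OF assms])
  have eq: "(\<integral>\<^sup>+x\<in>\<Omega>. ennreal (norm (f x)) \<partial>lborel) = (\<integral>\<^sup>+x. ennreal (norm (h x)) \<partial>lebesgue)"
    unfolding nn_integral_completion by (intro nn_integral_cong) (simp add: h_def indicator_def)
  show ?thesis
  proof (cases "(\<integral>\<^sup>+x. ennreal (norm (h x)) \<partial>lebesgue) < \<infinity>")
    case True
    with h have int: "integrable lebesgue h" by (simp add: integrable_iff_bounded)
    have "(h has_integral I) UNIV"
    proof -
      have "h = (\<lambda>x. if x \<in> \<Omega> then f x else 0)" by (auto simp: h_def)
      then show ?thesis using assms by (simp only: has_integral_restrict_UNIV)
    qed
    moreover have "(h has_integral integral\<^sup>L lebesgue h) UNIV"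
      by (rule has_integral_integral_lebesgue[OF int])
    ultimately have "I = integral\<^sup>L lebesgue h" by (rule has_integral_unique)
    then show ?thesis using integral_norm_bound_ennreal[OF int] eq by simp
  qed (auto simp: eq top_unique not_less)
qed

text \<open>For translation invariant measures the double integral of
  (x, y) \<mapsto> g y * f (T x + y), with g the indicator of the unit ball, can be evaluated
  in both orders; this identifies the image measure without computing determinants.\<close>

lemma nn_integral_lborel_isometry:
  fixes T T' :: "'a::euclidean_space \<Rightarrow> 'a" and f :: "'a \<Rightarrow> ennreal"
  assumes T: "\<And>x y. T (x + y) = T x + T y" "\<And>x. norm (T x) = norm x" "\<And>y. T (T' y) = y"
    and [measurable]: "T \<in> borel_measurable borel" "f \<in> borel_measurable borel"
  shows "(\<integral>\<^sup>+x. f (T x) \<partial>lborel) = (\<integral>\<^sup>+x. f x \<partial>lborel)"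
proof -
  have shift: "(\<integral>\<^sup>+x. u (c + x) \<partial>lborel) = (\<integral>\<^sup>+x. u x \<partial>lborel)"
    if [measurable]: "u \<in> borel_measurable borel" for u :: "'a \<Rightarrow> ennreal" and c
  proof -
    have "(\<integral>\<^sup>+x. u x \<partial>lborel) = (\<integral>\<^sup>+x. u x \<partial>distr lborel borel ((+) c))"
      by (simp add: lborel_distr_plus)
    also have "\<dots> = (\<integral>\<^sup>+x. u (c + x) \<partial>lborel)"
      by (rule nn_integral_distr) auto
    finally show ?thesis by simp
  qed
  have Tdiff: "T (x - y) = T x - T y" for x y using T(1)[of "x - y" y] by (simp add: algebra_simps)
  define B where "B = ball (0::'a) 1"
  define V where "V = emeasure lborel B"
  have [measurable]: "B \<in> sets borel" by (simp add: B_def)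
  have "(\<integral>\<^sup>+x. f (T x) \<partial>lborel) * V = (\<integral>\<^sup>+y. indicator B y * (\<integral>\<^sup>+x. f (T x) \<partial>lborel) \<partial>lborel)"
    by (simp add: nn_integral_multc V_def mult.commute)
  also have "\<dots> = (\<integral>\<^sup>+y. \<integral>\<^sup>+x. indicator B y * f (y + T x) \<partial>lborel \<partial>lborel)"
  proof (rule nn_integral_cong)
    fix y
    have "(\<integral>\<^sup>+x. f (T x) \<partial>lborel) = (\<integral>\<^sup>+x. f (T (T' y + x)) \<partial>lborel)"
      using shift[of "\<lambda>x. f (T x)" "T' y"] by simp
    then show "indicator B y * (\<integral>\<^sup>+x. f (T x) \<partial>lborel) = (\<integral>\<^sup>+x. indicator B y * f (y + T x) \<partial>lborel)"
      by (simp add: T nn_integral_cmult)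
  qed
  also have "\<dots> = (\<integral>\<^sup>+x. \<integral>\<^sup>+y. indicator B y * f (y + T x) \<partial>lborel \<partial>lborel)"
    by (rule lborel_pair.Fubini') measurable
  also have "\<dots> = (\<integral>\<^sup>+x. \<integral>\<^sup>+y. indicator B (y - T x) * f y \<partial>lborel \<partial>lborel)"
  proof (rule nn_integral_cong)
    fix x
    show "(\<integral>\<^sup>+y. indicator B y * f (y + T x) \<partial>lborel) = (\<integral>\<^sup>+y. indicator B (y - T x) * f y \<partial>lborel)"
      using shift[of "\<lambda>y. indicator B (y - T x) * f y" "T x"] by (simp add: add.commute)
  qed
  also have "\<dots> = (\<integral>\<^sup>+y. \<integral>\<^sup>+x. indicator B (y - T x) * f y \<partial>lborel \<partial>lborel)"
    by (rule lborel_pair.Fubini') measurable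
  also have "\<dots> = (\<integral>\<^sup>+y. V * f y \<partial>lborel)"
  proof (rule nn_integral_cong)
    fix y
    \<comment> \<open>Invariance of the norm turns the condition on \<open>T x\<close> into one on
      \<open>x\<close>; a translation in \<open>x\<close> then yields the volume \<open>V\<close>
      for every \<open>y\<close>.\<close>
    have "(indicator B (y - T x) :: ennreal) = indicator B (- T' y + x)" for x
    proof -
      have "norm (y - T x) = norm (- T' y + x)"
        using T(2)[of "T' y - x"] by (simp add: Tdiff T(3) norm_minus_commute)
      then show ?thesis by (simp add: B_def indicator_def)
    qed
    then show "(\<integral>\<^sup>+x. indicator B (y - T x) * f y \<partial>lborel) = V * f y"
      using shift[of "indicator B" "- T' y"] by (simp add: nn_integral_multc V_def)
  qed
  also have "\<dots> = (\<integral>\<^sup>+x. f x \<partial>lborel) * V"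
    by (simp add: nn_integral_cmult mult.commute)
  finally have *: "(\<integral>\<^sup>+x. f (T x) \<partial>lborel) * V = (\<integral>\<^sup>+x. f x \<partial>lborel) * V" .
  have "V \<noteq> \<infinity>" using emeasure_lborel_ball_finite[of "0::'a" 1] by (simp add: V_def B_def)
  moreover have "V \<noteq> 0"
    unfolding V_def B_def using open_not_negligible[of "ball (0::'a) 1"]
    by (auto simp: negligible_iff_emeasure0)
  ultimately show ?thesis using * by (metis mult_divide_eq_ennreal infinity_ennreal_def)
qed

lemma holomorphic_circle_mean:
  assumes "\<phi> holomorphic_on cball 0 1"
  shows "((\<lambda>t. \<phi> (exp (2 * of_real pi * \<i> * of_real t))) has_integral \<phi> 0) {0..1}"
proof -
  let ?e = "\<lambda>t. exp (2 * of_real pi * \<i> * of_real t)"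
  have "((\<lambda>u. \<phi> u / (u - 0)) has_contour_integral 2 * of_real pi * \<i> * \<phi> 0) (circlepath 0 1)"
    using Cauchy_integral_circlepath_simple[OF assms, of 0] by simp
  then have "((\<lambda>t. \<phi> (?e t) / ?e t * (2 * of_real pi * \<i> * ?e t)) has_integral 2 * of_real pi * \<i> * \<phi> 0) {0..1}"
    unfolding has_contour_integral_def
    by (rule has_integral_eq[rotated])
       (subst vector_derivative_circlepath01, auto simp: circlepath)
  then have "((\<lambda>t. 2 * of_real pi * \<i> * \<phi> (?e t)) has_integral 2 * of_real pi * \<i> * \<phi> 0) {0..1}"
    by (simp add: algebra_simps)
  from has_integral_mult_right[OF this, of "1 / (2 * of_real pi * \<i>)"] show ?thesis by simp
qed

section \<open>Calculus of holomorphic functions of several variables\<close>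

lemma holo_onD:
  assumes "f holo_on D" "z \<in> D"
  shows "(f has_derivative frechet_derivative f (at z)) (at z)"
    and "frechet_derivative f (at z) (c *s X) = c * frechet_derivative f (at z) X"
proof -
  obtain f' where f': "(f has_derivative f') (at z)" "\<And>c X. f' (c *s X) = c * f' X"
    using assms unfolding holo_on_def by blast
  then have "f' = frechet_derivative f (at z)" by (intro frechet_derivative_at)
  with f' show "(f has_derivative frechet_derivative f (at z)) (at z)"
    "frechet_derivative f (at z) (c *s X) = c * frechet_derivative f (at z) X" by simp_all
qed

lemma holo_on_continuous_on: "f holo_on D \<Longrightarrow> continuous_on D f"
  by (intro continuous_at_imp_continuous_on ballI has_derivative_continuous[OF holo_onD(1)])

lemma holo_on_line_derivative:
  assumes "f holo_on D" "z + t *s X \<in> D"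
  shows "((\<lambda>t. f (z + t *s X)) has_field_derivative frechet_derivative f (at (z + t *s X)) X) (at t)"
proof -
  have "((\<lambda>t. z + t *s X) has_derivative (\<lambda>h. h *s X)) (at t)"
    by (rule derivative_eq_intros bounded_linear.has_derivative[OF
          bounded_bilinear.bounded_linear_left[OF bounded_bilinear_smult]] has_derivative_ident | simp)+
  from has_derivative_compose[OF this holo_onD(1)[OF assms]]
  moreover have "(\<lambda>h. h * c) = (*) c" for c :: complex by (simp add: fun_eq_iff)
  ultimately show ?thesis
    unfolding has_field_derivative_def holo_onD(2)[OF assms] by simp
qed

lemma holo_on_comp_holomorphic:
  assumes "f holo_on D" "open U" "h holomorphic_on U" "f ` D \<subseteq> U"
  shows "(\<lambda>z. h (f z)) holo_on D"
    and "z \<in> D \<Longrightarrow> frechet_derivative (\<lambda>z. h (f z)) (at z) X = deriv h (f z) * frechet_derivative f (at z) X"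
proof -
  have d: "((\<lambda>z. h (f z)) has_derivative (\<lambda>X. deriv h (f z) * frechet_derivative f (at z) X)) (at z)"
    if "z \<in> D" for z
  proof -
    have "(h has_field_derivative deriv h (f z)) (at (f z))"
      using assms that by (intro holomorphic_derivI[OF assms(3,2)]) auto
    from has_derivative_compose[OF holo_onD(1)[OF assms(1) that] this[unfolded has_field_derivative_def]]
    show ?thesis .
  qed
  show "(\<lambda>z. h (f z)) holo_on D"
    unfolding holo_on_def
    by (intro ballI exI conjI, rule d) (auto simp: holo_onD(2)[OF assms(1)])
  show "frechet_derivative (\<lambda>z. h (f z)) (at z) X = deriv h (f z) * frechet_derivative f (at z) X"
    if "z \<in> D" using frechet_derivative_at[OF d[OF that]] by metis
qed

lemma holo_on_mult:
  assumes "f holo_on D" "g holo_on D"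
  shows "(\<lambda>z. f z * g z) holo_on D"
    and "z \<in> D \<Longrightarrow> frechet_derivative (\<lambda>z. f z * g z) (at z) X =
      f z * frechet_derivative g (at z) X + frechet_derivative f (at z) X * g z"
proof -
  have d: "((\<lambda>z. f z * g z) has_derivative (\<lambda>X. f z * frechet_derivative g (at z) X + frechet_derivative f (at z) X * g z)) (at z)"
    if "z \<in> D" for z
    by (rule has_derivative_mult[OF holo_onD(1)[OF assms(1) that] holo_onD(1)[OF assms(2) that]])
  show "(\<lambda>z. f z * g z) holo_on D"
    unfolding holo_on_def
    by (intro ballI exI conjI, rule d)
       (auto simp: holo_onD(2)[OF assms(1)] holo_onD(2)[OF assms(2)] algebra_simps)
  show "frechet_derivative (\<lambda>z. f z * g z) (at z) X =
      f z * frechet_derivative g (at z) X + frechet_derivative f (at z) X * g z"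
    if "z \<in> D" using frechet_derivative_at[OF d[OF that]] by metis
qed

lemma holo_on_const: "(\<lambda>z. c) holo_on D"
  and frechet_derivative_holo_const: "frechet_derivative (\<lambda>z. c) (at z) X = 0"
  unfolding holo_on_def by (auto intro!: exI[of _ "\<lambda>_. 0"])

section \<open>Point and derivative estimates in the Bergman space\<close>

text \<open>The rotations of all coordinates by a common unit scalar preserve the ball and Lebesgue
  measure. So the integral over the ball equals its average over these rotations, and after
  exchanging the integrals the mean value property on the discs \<open>z + t *s x\<close> bounds it
  from below.\<close>

lemma mean_value_ball:
  fixes D :: "(complex^'n) set"
  assumes f: "f holo_on D" and R: "0 < R" "ball z R \<subseteq> D"
  shows "ennreal ((cmod (f z))\<^sup>2) * emeasure lborel (ball (0::complex^'n) R)
    \<le> (\<integral>\<^sup>+x\<in>ball z R. ennreal ((cmod (f x))\<^sup>2) \<partial>lborel)"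
proof -
  define B where "B = ball (0::complex^'n) R"
  define e where "e = (\<lambda>t::real. exp (2 * of_real pi * \<i> * of_real t))"
  have e: "cmod (e t) = 1" for t by (simp add: e_def)
  define u where "u = (\<lambda>x. ennreal ((indicator B x *\<^sub>R (cmod (f (z + x)))\<^sup>2)))"
  have zB: "z + x \<in> D" if "x \<in> B" for x
    using that R by (auto simp: B_def dist_norm subset_iff)
  have "continuous_on B (\<lambda>x. (cmod (f (z + x)))\<^sup>2)"
    by (intro continuous_intros continuous_on_compose2[OF holo_on_continuous_on[OF f]]) (use zB in auto)
  then have u[measurable]: "u \<in> borel_measurable borel"
    unfolding u_def
    by (intro measurable_compose[OF _ measurable_ennreal] borel_measurable_continuous_on_indicator)
       (simp add: B_def)
  have smeas[measurable]:
    "(\<lambda>p. e (snd p) *s (fst p :: complex^'n)) \<in> borel_measurable (borel \<Otimes>\<^sub>M borel)"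
    unfolding borel_prod e_def by (intro borel_measurable_continuous_onI continuous_intros)
  have [measurable]: "{0..1::real} \<in> sets borel" by simp
  have smeas2[measurable]: "(\<lambda>x. c *s (x :: complex^'n)) \<in> borel_measurable borel" for c
    by (intro borel_measurable_continuous_onI continuous_intros)
  have "ennreal ((cmod (f z))\<^sup>2) * emeasure lborel B = (\<integral>\<^sup>+x\<in>B. ennreal ((cmod (f z))\<^sup>2) \<partial>lborel)"
    by (simp add: nn_integral_cmult_indicator B_def)
  also have "\<dots> \<le> (\<integral>\<^sup>+x. (\<integral>\<^sup>+t\<in>{0..1}. u (e t *s x) \<partial>lborel) \<partial>lborel)"
  proof (rule nn_integral_mono)
    fix x :: "complex^'n"
    show "ennreal ((cmod (f z))\<^sup>2) * indicator B x \<le> (\<integral>\<^sup>+t\<in>{0..1}. u (e t *s x) \<partial>lborel)"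
    proof (cases "x \<in> B")
      case True
      \<comment> \<open>Squaring before taking the mean keeps the function holomorphic while its
        modulus is the integrand.\<close>
      define \<phi> where "\<phi> = (\<lambda>t. (f (z + t *s x))\<^sup>2)"
      have in_D: "z + t *s x \<in> D" if "t \<in> cball 0 1" for t
      proof (rule zB)
        have "cmod t * norm x \<le> norm x" using that by (simp add: mult_left_le_one_le)
        then show "t *s x \<in> B" using True by (simp add: B_def norm_smult)
      qed
      have "\<phi> holomorphic_on cball 0 1"
        unfolding \<phi>_def
      proof (intro holomorphic_intros)
        show "(\<lambda>t. f (z + t *s x)) holomorphic_on cball 0 1"
          unfolding holomorphic_on_def
          using holo_on_line_derivative[OF f in_D]
          by (meson field_differentiable_at_within field_differentiable_def)
      qed
      from norm_has_integral_le_nn_integral[OF holomorphic_circle_mean[OF this]]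
      have "ennreal (cmod (\<phi> 0)) \<le> (\<integral>\<^sup>+t\<in>{0..1}. ennreal (cmod (\<phi> (e t))) \<partial>lborel)"
        by (simp add: e_def)
      also have "\<dots> = (\<integral>\<^sup>+t\<in>{0..1}. u (e t *s x) \<partial>lborel)"
        using True by (intro nn_integral_cong)
          (simp add: \<phi>_def u_def B_def norm_smult e norm_power)
      finally show ?thesis using True by (simp add: \<phi>_def norm_power)
    qed simp
  qed
  also have "\<dots> = (\<integral>\<^sup>+t. \<integral>\<^sup>+x. u (e t *s x) * indicator {0..1} t \<partial>lborel \<partial>lborel)"
    by (rule lborel_pair.Fubini'[symmetric]) (unfold case_prod_unfold, measurable)
  also have "\<dots> = (\<integral>\<^sup>+t\<in>{0..1}. (\<integral>\<^sup>+x. u (e t *s x) \<partial>lborel) \<partial>lborel)"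
    by (intro nn_integral_cong nn_integral_multc) measurable
  also have "\<dots> = (\<integral>\<^sup>+t\<in>{0..1::real}. (\<integral>\<^sup>+x. u x \<partial>lborel) \<partial>lborel)"
  proof (rule nn_integral_cong)
    fix t :: real
    have "e t * cnj (e t) = 1" by (simp add: e flip: complex_norm_square)
    then have "(\<integral>\<^sup>+x. u (e t *s x) \<partial>lborel) = (\<integral>\<^sup>+x. u x \<partial>lborel)"
      by (intro nn_integral_lborel_isometry[where T' = "\<lambda>y. cnj (e t) *s y"])
         (auto simp: norm_smult e vector_smult_assoc vector_add_ldistrib)
    then show "(\<integral>\<^sup>+x. u (e t *s x) \<partial>lborel) * indicator {0..1} t =
        (\<integral>\<^sup>+x. u x \<partial>lborel) * indicator {0..1} t" by simp
  qed
  also have "\<dots> = (\<integral>\<^sup>+x. u x \<partial>lborel)" by (simp add: nn_integral_cmult)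
  also have "\<dots> = (\<integral>\<^sup>+x. u (- z + x) \<partial>lborel)"
  proof -
    have "(\<integral>\<^sup>+x. u x \<partial>lborel) = (\<integral>\<^sup>+x. u x \<partial>distr lborel borel ((+) (- z)))"
      by (simp add: lborel_distr_plus)
    also have "\<dots> = (\<integral>\<^sup>+x. u (- z + x) \<partial>lborel)"
      by (rule nn_integral_distr) auto
    finally show ?thesis .
  qed
  also have "\<dots> = (\<integral>\<^sup>+x\<in>ball z R. ennreal ((cmod (f x))\<^sup>2) \<partial>lborel)"
    by (intro nn_integral_cong) (simp add: u_def B_def indicator_def dist_norm norm_minus_commute)
  finally show ?thesis by (simp add: B_def)
qed

lemma L2h_sup_bound:
  fixes D :: "(complex^'n) set"
  assumes "open D" "f \<in> L2h D" "0 < R" "ball z R \<subseteq> D"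
  shows "(cmod (f z))\<^sup>2 * measure lborel (ball (0::complex^'n) R) \<le> (L2_norm D f)\<^sup>2"
proof -
  have int: "set_integrable lborel D (\<lambda>z. (cmod (f z))\<^sup>2)" and h: "f holo_on D"
    using assms(2) by (auto simp: L2h_def)
  have nn: "(\<integral>\<^sup>+x\<in>D. ennreal ((cmod (f x))\<^sup>2) \<partial>lborel) = ennreal (LINT x:D|lborel. (cmod (f x))\<^sup>2)"
  proof -
    have "(\<integral>\<^sup>+x. ennreal (indicator D x *\<^sub>R (cmod (f x))\<^sup>2) \<partial>lborel)
        = ennreal (LINT x:D|lborel. (cmod (f x))\<^sup>2)"
      using int unfolding set_integrable_def set_lebesgue_integral_def
      by (intro nn_integral_eq_integral) auto
    then show ?thesis
      by (subst (asm) nn_integral_cong[where v = "\<lambda>x. ennreal ((cmod (f x))\<^sup>2) * indicator D x"])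
         (auto simp: indicator_def)
  qed
  have nonneg: "0 \<le> (LINT x:D|lborel. (cmod (f x))\<^sup>2)"
    unfolding set_lebesgue_integral_def by (intro integral_nonneg_AE) auto
  have fin: "emeasure lborel (ball (0::complex^'n) R) = ennreal (measure lborel (ball (0::complex^'n) R))"
    using emeasure_lborel_ball_finite[of "0::complex^'n" R] by (simp add: emeasure_eq_ennreal_measure)
  have "ennreal ((cmod (f z))\<^sup>2 * measure lborel (ball (0::complex^'n) R))
      = ennreal ((cmod (f z))\<^sup>2) * emeasure lborel (ball (0::complex^'n) R)"
    unfolding fin by (simp add: ennreal_mult)
  also have "\<dots> \<le> (\<integral>\<^sup>+x\<in>ball z R. ennreal ((cmod (f x))\<^sup>2) \<partial>lborel)"
    by (rule mean_value_ball[OF h assms(3,4)])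
  also have "\<dots> \<le> (\<integral>\<^sup>+x\<in>D. ennreal ((cmod (f x))\<^sup>2) \<partial>lborel)"
    using assms(4) by (intro nn_integral_mono) (auto simp: indicator_def)
  finally show ?thesis
    unfolding nn by (subst (asm) ennreal_le_iff) (use nonneg in \<open>auto simp: L2_norm_def\<close>)
qed

text \<open>Makes the set in \<open>bergman_M\<close> bounded above, so that its real supremum
  dominates each competitor. It is the Cauchy estimate on a disc in direction \<open>X\<close>, fed
  with the mean value bound.\<close>

lemma L2h_derivative_bound:
  fixes D :: "(complex^'n) set"
  assumes "open D" "z \<in> D"
  obtains C where "0 \<le> C" "\<And>f. f \<in> L2h D \<Longrightarrow> cmod (frechet_derivative f (at z) X) \<le> C * L2_norm D f"
proof -
  obtain r where r: "r > 0" "ball z r \<subseteq> D" using assms open_contains_ball by blast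
  \<comment> \<open>Half the radius, because the mean value bound is used on balls of radius
    \<open>R\<close> centred anywhere in \<open>ball z R\<close>.\<close>
  define R where "R = r / 2"
  have R: "R > 0" using r by (simp add: R_def)
  define V where "V = measure lborel (ball (0::complex^'n) R)"
  have V: "V > 0"
    using R unfolding V_def by (simp add: content_ball_pos)
  \<comment> \<open>Adding 1 keeps the denominator positive when \<open>X = 0\<close> and makes
    \<open>s * norm X < R\<close> strict.\<close>
  define s where "s = R / (norm X + 1)"
  have nX: "norm X + 1 > 0" using norm_ge_zero[of X] by linarith
  have s: "s > 0" using R nX by (simp add: s_def)
  have sX: "s * norm X < R"
  proof -
    have "s * norm X < s * (norm X + 1)" using s by simp
    also have "\<dots> = R" using nX by (simp add: s_def)
    finally show ?thesis .
  qed
  have *: "cmod (frechet_derivative f (at z) X) \<le> (1 / (sqrt V * s)) * L2_norm D f" if f: "f \<in> L2h D" for f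
  proof -
    have h: "f holo_on D" using f by (simp add: L2h_def)
    define N where "N = L2_norm D f"
    have N: "N \<ge> 0"
      unfolding N_def L2_norm_def set_lebesgue_integral_def by (auto intro!: integral_nonneg_AE)
    have inB: "z + t *s X \<in> ball z R" if "cmod t \<le> s" for t
    proof -
      have "norm (t *s X) \<le> s * norm X" using that by (simp add: norm_smult mult_right_mono)
      then show ?thesis using sX by (simp add: dist_norm)
    qed
    have inD: "z + t *s X \<in> D" if "cmod t \<le> s" for t
      using inB[OF that] r R by (auto simp: R_def subset_iff)
    have bound: "cmod (f y) \<le> N / sqrt V" if y: "y \<in> ball z R" for y
    proof -
      have "ball y R \<subseteq> D"
      proof
        fix x assume "x \<in> ball y R"
        with y have "dist z x < r" using dist_triangle[of z x y] by (simp add: R_def)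
        then show "x \<in> D" using r by auto
      qed
      from L2h_sup_bound[OF assms(1) f R this]
      have "(cmod (f y))\<^sup>2 \<le> (N / sqrt V)\<^sup>2"
        using V by (simp add: N_def V_def power_divide pos_le_divide_eq)
      then show ?thesis by (rule power2_le_imp_le) (use N V in auto)
    qed
    define \<phi> where "\<phi> = (\<lambda>t. f (z + t *s X))"
    have der: "(\<phi> has_field_derivative frechet_derivative f (at (z + t *s X)) X) (at t)" if "cmod t \<le> s" for t
      unfolding \<phi>_def by (rule holo_on_line_derivative[OF h inD[OF that]])
    have hol: "\<phi> holomorphic_on cball 0 s"
      unfolding holomorphic_on_def
      using der by (metis dist_0_norm field_differentiable_at_within field_differentiable_def mem_cball)
    have "norm ((deriv ^^ 1) \<phi> 0) \<le> fact 1 * (N / sqrt V) / s ^ 1"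
    proof (rule Cauchy_inequality)
      show "\<phi> holomorphic_on ball 0 s" by (rule holomorphic_on_subset[OF hol]) auto
      show "continuous_on (cball 0 s) \<phi>" by (rule holomorphic_on_imp_continuous_on[OF hol])
      show "cmod (\<phi> t) \<le> N / sqrt V" if "cmod (0 - t) = s" for t
        using bound[OF inB] that by (simp add: \<phi>_def)
    qed (rule s)
    moreover have "deriv \<phi> 0 = frechet_derivative f (at z) X"
      using der[of 0] s by (simp add: DERIV_imp_deriv)
    ultimately show ?thesis by (simp add: N_def)
  qed
  have "0 \<le> 1 / (sqrt V * s)" using V s by simp
  then show thesis using * by (rule that)
qed

lemma L2_norm_nonneg: "0 \<le> L2_norm D f"
  unfolding L2_norm_def set_lebesgue_integral_def by (auto intro!: integral_nonneg_AE)

lemma L2_norm_squared: "(L2_norm D f)\<^sup>2 = (LINT z:D|lborel. (cmod (f z))\<^sup>2)"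
  unfolding L2_norm_def
  by (rule real_sqrt_pow2) (auto simp: set_lebesgue_integral_def intro!: integral_nonneg_AE)

lemma L2h_mult_bounded:
  fixes D :: "(complex^'n) set"
  assumes "open D" "f \<in> L2h D" "\<phi> holo_on D" "\<And>z. z \<in> D \<Longrightarrow> cmod (\<phi> z) \<le> c"
  shows "(\<lambda>z. \<phi> z * f z) \<in> L2h D" "L2_norm D (\<lambda>z. \<phi> z * f z) \<le> \<bar>c\<bar> * L2_norm D f"
proof -
  have h: "(\<lambda>z. \<phi> z * f z) holo_on D"
    using holo_on_mult(1)[OF assms(3)] assms(2) by (simp add: L2h_def)
  have int: "set_integrable lborel D (\<lambda>z. c\<^sup>2 * (cmod (f z))\<^sup>2)"
    using assms(2) by (simp add: L2h_def)
  have le: "(cmod (\<phi> z * f z))\<^sup>2 \<le> c\<^sup>2 * (cmod (f z))\<^sup>2" if "z \<in> D" for z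
    using assms(4)[OF that] unfolding norm_mult power_mult_distrib
    by (intro mult_right_mono power_mono) auto
  have int2: "set_integrable lborel D (\<lambda>z. (cmod (\<phi> z * f z))\<^sup>2)"
  proof (rule set_integrable_bound[OF int])
    have "continuous_on D (\<lambda>z. (cmod (\<phi> z * f z))\<^sup>2)"
      by (intro continuous_intros holo_on_continuous_on[OF h])
    from borel_measurable_continuous_on_indicator[OF borel_open[OF assms(1)] this]
    show "set_borel_measurable lborel D (\<lambda>z. (cmod (\<phi> z * f z))\<^sup>2)"
      unfolding set_borel_measurable_def by (simp only: measurable_cong_sets[OF sets_lborel refl])
    show "AE x in lborel. x \<in> D \<longrightarrow> norm ((cmod (\<phi> x * f x))\<^sup>2) \<le> norm (c\<^sup>2 * (cmod (f x))\<^sup>2)"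
      using le by (intro AE_I2) auto
  qed
  show "(\<lambda>z. \<phi> z * f z) \<in> L2h D" using h int2 by (simp add: L2h_def)
  have "(LINT z:D|lborel. (cmod (\<phi> z * f z))\<^sup>2) \<le> (LINT z:D|lborel. c\<^sup>2 * (cmod (f z))\<^sup>2)"
    by (rule set_integral_mono[OF int2 int]) (rule le)
  also have "\<dots> = c\<^sup>2 * (LINT z:D|lborel. (cmod (f z))\<^sup>2)" by simp
  finally show "L2_norm D (\<lambda>z. \<phi> z * f z) \<le> \<bar>c\<bar> * L2_norm D f"
    unfolding L2_norm_def by (metis real_sqrt_abs real_sqrt_le_iff real_sqrt_mult)
qed

lemma const_in_L2h:
  fixes D :: "(complex^'n) set"
  assumes "open D" "bounded D"
  shows "(\<lambda>z. c) \<in> L2h D" "L2_norm D (\<lambda>z. c) = cmod c * sqrt (measure lborel D)"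
proof -
  have D: "D \<in> sets lborel" "emeasure lborel D < \<infinity>"
    using assms emeasure_bounded_finite[of D] by auto
  then have "set_integrable lborel D (\<lambda>z. (cmod c)\<^sup>2)"
    unfolding set_integrable_def by (intro integrable_scaleR_left) (simp add: integrable_indicator_iff)
  then show "(\<lambda>z. c) \<in> L2h D" by (simp add: L2h_def holo_on_const)
  show "L2_norm D (\<lambda>z. c) = cmod c * sqrt (measure lborel D)"
    using D by (simp add: L2_norm_def set_lebesgue_integral_def real_sqrt_mult)
qed

section \<open>Lower bounds for the Bergman metric\<close>

text \<open>The competitor is \<open>f\<close> times \<open>F\<close> followed by the automorphism
  \<open>m\<close> taking \<open>F z\<close> to 0. It vanishes at \<open>z\<close>, its norm is at
  most that of \<open>f\<close>, and since the derivative of \<open>m\<close> at \<open>F z\<close>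
  is 1 / (1 - |F z|^2), only the derivative of the first factor contributes at
  \<open>z\<close>.\<close>

lemma bergman_M_ge:
  fixes D :: "(complex^'n) set"
  assumes "open D" "bounded D" "z \<in> D" "f \<in> L2h D" "L2_norm D f \<le> 1"
    and F: "F holo_on D" "F ` D \<subseteq> ball 0 1" and nz: "f z * frechet_derivative F (at z) X \<noteq> 0"
  shows "cmod (f z) * (cmod (frechet_derivative F (at z) X) / (1 - (cmod (F z))\<^sup>2)) \<le> bergman_M D z X"
proof -
  define a where "a = F z"
  have a: "cmod a < 1" using F(2) assms(3) by (auto simp: a_def)
  define m where "m = Moebius_function 0 a"
  have m: "m holomorphic_on ball 0 1" "\<And>w. w \<in> ball 0 1 \<Longrightarrow> m w \<in> ball 0 1"
    using Moebius_function_holomorphic[of a] Moebius_function_norm_lt_1[of a] a by (simp_all add: m_def)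
  have ma: "m a = 0" by (simp add: m_def Moebius_function_simple)
  have a2: "1 - a * cnj a = of_real (1 - (cmod a)\<^sup>2)" by (simp flip: complex_norm_square)
  have a1: "(cmod a)\<^sup>2 < 1" using a by (simp add: power_less_one_iff)
  have dm: "deriv m a = 1 / of_real (1 - (cmod a)\<^sup>2)"
  proof -
    have den: "1 - cnj a * a \<noteq> 0"
      using a1 a2 by (metis mult.commute of_real_eq_0_iff diff_gt_0_iff_gt less_irrefl)
    have "((\<lambda>z. (z - a) / (1 - cnj a * z)) has_field_derivative
        ((1 - 0) * (1 - cnj a * a) - (a - a) * (0 - cnj a * 1)) / ((1 - cnj a * a) * (1 - cnj a * a))) (at a)"
      using den by (intro DERIV_divide DERIV_diff DERIV_ident DERIV_const DERIV_cmult)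
    moreover have "m = (\<lambda>z. (z - a) / (1 - cnj a * z))"
      by (simp add: m_def Moebius_function_simple fun_eq_iff)
    ultimately have "(m has_field_derivative 1 / (1 - cnj a * a)) (at a)" using den by simp
    then show ?thesis using a2 by (simp add: DERIV_imp_deriv mult.commute)
  qed
  define \<phi> where "\<phi> = (\<lambda>z. m (F z))"
  have \<phi>: "\<phi> holo_on D" "frechet_derivative \<phi> (at z) X = deriv m a * frechet_derivative F (at z) X"
    unfolding \<phi>_def a_def
    using holo_on_comp_holomorphic[OF F(1) open_ball m(1) F(2)] assms(3) by (simp_all add: a_def)
  have \<phi>1: "cmod (\<phi> x) \<le> 1" if "x \<in> D" for x
  proof -
    have "m (F x) \<in> ball 0 1" using m(2) F(2) that by blast
    then show ?thesis by (simp add: \<phi>_def)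
  qed
  define g where "g = (\<lambda>z. \<phi> z * f z)"
  have g: "g \<in> L2h D" "L2_norm D g \<le> 1"
    using L2h_mult_bounded[OF assms(1,4) \<phi>(1) \<phi>1] assms(5) by (auto simp: g_def)
  have \<phi>z: "\<phi> z = 0" by (simp add: \<phi>_def ma flip: a_def)
  have g': "frechet_derivative g (at z) X = deriv m a * frechet_derivative F (at z) X * f z"
    unfolding g_def using holo_on_mult(2)[OF \<phi>(1), of f z X] assms(3,4) \<phi>(2) \<phi>z by (simp add: L2h_def)
  obtain C where C: "0 \<le> C" "\<And>f. f \<in> L2h D \<Longrightarrow> cmod (frechet_derivative f (at z) X) \<le> C * L2_norm D f"
    using L2h_derivative_bound[OF assms(1,3)] by blast
  have "complex_of_real (1 - (cmod a)\<^sup>2) \<noteq> 0" using a1 by (simp only: of_real_eq_0_iff)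
  then have "deriv m a \<noteq> 0" unfolding dm by simp
  then have "frechet_derivative g (at z) X \<noteq> 0" using g' nz by simp
  \<comment> \<open>A nonzero derivative excludes norm 0, so \<open>g\<close> can be rescaled to
    norm exactly 1; as its norm is at most 1, this does not shrink the derivative.\<close>
  then have "0 < C * L2_norm D g" using C(2)[OF g(1)] by (smt (verit) zero_less_norm_iff)
  then have N: "L2_norm D g > 0" using C(1) L2_norm_nonneg[of D g] by (metis mult_zero_right order_le_less)
  define k where "k = (\<lambda>x. of_real (1 / L2_norm D g) * g x)"
  have k: "k \<in> L2h D" "k z = 0"
    "frechet_derivative k (at z) X = of_real (1 / L2_norm D g) * frechet_derivative g (at z) X"
  proof -
    show "k \<in> L2h D"
      unfolding k_def by (rule L2h_mult_bounded(1)[OF assms(1) g(1) holo_on_const]) auto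
    show "k z = 0" by (simp add: k_def g_def \<phi>z)
    show "frechet_derivative k (at z) X = of_real (1 / L2_norm D g) * frechet_derivative g (at z) X"
    proof -
      have "g holo_on D" using g(1) by (simp add: L2h_def)
      from holo_on_mult(2)[OF holo_on_const[of "of_real (1 / L2_norm D g)"] this assms(3), of X]
      show ?thesis
        unfolding k_def frechet_derivative_holo_const by (simp only: mult_zero_left add_0_right)
    qed
  qed
  have kN: "L2_norm D k = 1"
  proof -
    have "(cmod (k x))\<^sup>2 = (1 / L2_norm D g)\<^sup>2 * (cmod (g x))\<^sup>2" for x
      by (simp add: k_def norm_divide power_divide)
    then have "(L2_norm D k)\<^sup>2 = (1 / L2_norm D g)\<^sup>2 * (L2_norm D g)\<^sup>2"
      unfolding L2_norm_squared by simp
    also have "(1 / L2_norm D g)\<^sup>2 * (L2_norm D g)\<^sup>2 = 1" using N by (simp add: power_divide)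
    finally show ?thesis using L2_norm_nonneg[of D k] by (simp add: power2_eq_1_iff)
  qed
  have "cmod (frechet_derivative k (at z) X) \<le> bergman_M D z X"
    unfolding bergman_M_def
  proof (rule cSUP_upper)
    show "k \<in> {f \<in> L2h D. L2_norm D f = 1 \<and> f z = 0}" using k kN by simp
    show "bdd_above ((\<lambda>f. cmod (frechet_derivative f (at z) X)) ` {f \<in> L2h D. L2_norm D f = 1 \<and> f z = 0})"
      using C(2) by (intro bdd_aboveI[of _ C]) force
  qed
  moreover have "cmod (frechet_derivative g (at z) X) \<le> cmod (frechet_derivative k (at z) X)"
    using N g(2) by (simp add: k(3) norm_mult norm_divide le_divide_eq mult_left_le)
  moreover have "cmod (frechet_derivative g (at z) X)
      = cmod (f z) * (cmod (frechet_derivative F (at z) X) / (1 - (cmod (F z))\<^sup>2))"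
  proof -
    have "cmod (deriv m a) = 1 / (1 - (cmod a)\<^sup>2)"
      unfolding dm norm_divide norm_one norm_of_real using a1 by simp
    then show ?thesis by (simp add: g' norm_mult a_def)
  qed
  ultimately show ?thesis by linarith
qed

text \<open>The estimate |f z| v \<le> M holds for every \<open>f\<close> in the unit ball of the
  Bergman space. Taking the supremum over \<open>f\<close> turns it into sqrt K \<le> M / v, which
  is the claim after division.\<close>

lemma bergman_metric_ge:
  fixes D :: "(complex^'n) set"
  assumes D: "open D" "bounded D" "z \<in> D"
    and F: "F holo_on D" "F ` D \<subseteq> ball 0 1" and nz: "frechet_derivative F (at z) X \<noteq> 0"
  shows "cmod (frechet_derivative F (at z) X) / (1 - (cmod (F z))\<^sup>2) \<le> bergman_metric D z X"
proof -
  define v where "v = cmod (frechet_derivative F (at z) X) / (1 - (cmod (F z))\<^sup>2)"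
  have "cmod (F z) < 1" using F(2) D(3) by auto
  then have "(cmod (F z))\<^sup>2 < 1" by (simp add: power_less_one_iff)
  then have v: "v > 0" using nz by (simp add: v_def)
  define M where "M = bergman_M D z X"
  have le: "cmod (f z) * v \<le> M" if "f \<in> L2h D" "L2_norm D f \<le> 1" "f z \<noteq> 0" for f
    using bergman_M_ge[OF D that(1,2) F, of X] that(3) nz by (simp add: v_def M_def)
  define V where "V = sqrt (measure lborel D)"
  \<comment> \<open>A constant function in the unit ball, with 1 as value should \<open>V\<close> be
    0. It shows that both \<open>M\<close> and the kernel are positive.\<close>
  define c where "c = (if V = 0 then 1 else 1 / V)"
  have V0: "V \<ge> 0" by (simp add: V_def)
  have c: "c > 0" using V0 by (auto simp: c_def)
  have f0: "(\<lambda>z. complex_of_real c) \<in> L2h D" "L2_norm D (\<lambda>z. complex_of_real c) \<le> 1"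
    using const_in_L2h[OF D(1,2), of "complex_of_real c"] c
    by (auto simp: V_def[symmetric] c_def)
  have "c * v \<le> M" using le[OF f0] c by simp
  then have M: "M > 0" using c v by (smt (verit) mult_pos_pos)
  have sq: "(cmod (f z))\<^sup>2 \<le> (M / v)\<^sup>2" if "f \<in> L2h D" "L2_norm D f \<le> 1" for f
  proof (cases "f z = 0")
    case False
    then have "cmod (f z) \<le> M / v" using le[OF that] v by (simp add: le_divide_eq)
    then show ?thesis by (intro power_mono) auto
  qed simp
  let ?A = "{f \<in> L2h D. L2_norm D f \<le> 1}"
  have ne: "?A \<noteq> {}" using f0 by blast
  have bdd: "bdd_above ((\<lambda>f. (cmod (f z))\<^sup>2) ` ?A)"
    using sq by (intro bdd_aboveI[of _ "(M / v)\<^sup>2"]) auto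
  have "bergman_kernel D z \<le> (M / v)\<^sup>2"
    unfolding bergman_kernel_def using sq by (intro cSUP_least[OF ne]) auto
  then have "sqrt (bergman_kernel D z) \<le> M / v"
    using M v real_sqrt_le_mono by fastforce
  moreover have "c\<^sup>2 \<le> bergman_kernel D z"
    unfolding bergman_kernel_def
    by (rule cSUP_upper2[OF bdd, of "\<lambda>z. complex_of_real c"]) (use f0 in auto)
  then have "bergman_kernel D z > 0" using c by (smt (verit) zero_less_power)
  ultimately have "v \<le> M / sqrt (bergman_kernel D z)"
    using v by (simp add: le_divide_eq mult.commute)
  then show ?thesis by (simp add: v_def M_def bergman_metric_def)
qed

text \<open>The hyperbolic length of a curve from 0 to a nonnegative real point. Integrating the
  holomorphic primitive \<open>A\<close> of 1 / (1 - \<zeta>^2), rather than differentiating |u|,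
  avoids the zeros of \<open>u\<close>; the estimate |1 - u^2| \<ge> 1 - |u|^2 then brings in the
  hyperbolic density.\<close>

lemma artanh_le_nn_integral:
  fixes u :: "real \<Rightarrow> complex"
  assumes u: "\<And>t. t \<in> {0..1} \<Longrightarrow> (u has_vector_derivative u' t) (at t within {0..1})"
    and u1: "\<And>t. t \<in> {0..1} \<Longrightarrow> cmod (u t) < 1" and "u 0 = 0" "u 1 = of_real (cmod (u 1))"
  shows "ennreal (artanh (cmod (u 1))) \<le> (\<integral>\<^sup>+t\<in>{0..1}. ennreal (cmod (u' t) / (1 - (cmod (u t))\<^sup>2)) \<partial>lborel)"
proof -
  define A where "A = (\<lambda>\<zeta>. (Ln (1 + \<zeta>) - Ln (1 - \<zeta>)) / 2)"
  have A: "(A has_field_derivative 1 / (1 - \<zeta>\<^sup>2)) (at \<zeta>)" if "cmod \<zeta> < 1" for \<zeta>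
  proof -
    have re: "\<bar>Re \<zeta>\<bar> < 1" using that abs_Re_le_cmod[of \<zeta>] by linarith
    then have nn: "1 + \<zeta> \<notin> \<real>\<^sub>\<le>\<^sub>0" "1 - \<zeta> \<notin> \<real>\<^sub>\<le>\<^sub>0"
      by (auto simp: complex_nonpos_Reals_iff)
    then have nz: "1 + \<zeta> \<noteq> 0" "1 - \<zeta> \<noteq> 0" by auto
    have "(A has_field_derivative (1 / (1 + \<zeta>) + 1 / (1 - \<zeta>)) / 2) (at \<zeta>)"
      unfolding A_def using nn by (auto intro!: derivative_eq_intros simp: inverse_eq_divide)
    moreover have "(1 / (1 + \<zeta>) + 1 / (1 - \<zeta>)) / 2 = 1 / (1 - \<zeta>\<^sup>2)"
    proof -
      have "1 - \<zeta>\<^sup>2 = (1 + \<zeta>) * (1 - \<zeta>)" by (simp add: power2_eq_square algebra_simps)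
      then show ?thesis using nz by (simp add: add_divide_eq_iff divide_add_eq_iff)
    qed
    ultimately show ?thesis by simp
  qed
  have "((\<lambda>t. u' t * (1 / (1 - (u t)\<^sup>2))) has_integral A (u 1) - A (u 0)) {0..1}"
  proof (rule fundamental_theorem_of_calculus)
    fix t :: real assume t: "t \<in> {0..1}"
    show "((\<lambda>t. A (u t)) has_vector_derivative u' t * (1 / (1 - (u t)\<^sup>2))) (at t within {0..1})"
      using field_vector_diff_chain_within[OF u[OF t] has_field_derivative_at_within[OF A[OF u1[OF t]]]]
      by (simp add: o_def)
  qed simp
  from norm_has_integral_le_nn_integral[OF this]
  have "ennreal (cmod (A (u 1) - A (u 0))) \<le> (\<integral>\<^sup>+t\<in>{0..1}. ennreal (cmod (u' t * (1 / (1 - (u t)\<^sup>2)))) \<partial>lborel)" .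
  also have "\<dots> \<le> (\<integral>\<^sup>+t\<in>{0..1}. ennreal (cmod (u' t) / (1 - (cmod (u t))\<^sup>2)) \<partial>lborel)"
  proof (intro nn_integral_mono)
    fix t :: real
    show "ennreal (cmod (u' t * (1 / (1 - (u t)\<^sup>2)))) * indicator {0..1} t
        \<le> ennreal (cmod (u' t) / (1 - (cmod (u t))\<^sup>2)) * indicator {0..1} t"
    proof (cases "t \<in> {0..1}")
      case True
      have lt: "(cmod (u t))\<^sup>2 < 1" using u1[OF True] by (simp add: power_less_one_iff)
      have "1 - (cmod (u t))\<^sup>2 \<le> cmod (1 - (u t)\<^sup>2)"
        using norm_triangle_ineq2[of 1 "(u t)\<^sup>2"] by (simp add: norm_power)
      then have "cmod (u' t) / cmod (1 - (u t)\<^sup>2) \<le> cmod (u' t) / (1 - (cmod (u t))\<^sup>2)"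
        using lt by (intro divide_left_mono mult_pos_pos) auto
      then show ?thesis using True by (simp add: norm_divide ennreal_leI)
    qed simp
  qed
  finally have le: "ennreal (cmod (A (u 1) - A (u 0)))
    \<le> (\<integral>\<^sup>+t\<in>{0..1}. ennreal (cmod (u' t) / (1 - (cmod (u t))\<^sup>2)) \<partial>lborel)" .
  define r where "r = cmod (u 1)"
  have r: "0 \<le> r" "r < 1" using u1[of 1] by (auto simp: r_def)
  have "A (of_real r) = of_real (artanh r)"
  proof -
    have "Ln (1 + of_real r) = of_real (ln (1 + r))" using Ln_of_real[of "1 + r"] r by simp
    moreover have "Ln (1 - of_real r) = of_real (ln (1 - r))" using Ln_of_real[of "1 - r"] r by simp
    ultimately show ?thesis using r by (simp add: A_def artanh_def ln_div)
  qed
  then have "A (u 1) - A (u 0) = of_real (artanh r)"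
    using assms(3,4) by (simp add: r_def A_def)
  then have "cmod (A (u 1) - A (u 0)) = \<bar>artanh r\<bar>" by simp
  then have "artanh r \<le> cmod (A (u 1) - A (u 0))" by simp
  then have "ennreal (artanh r) \<le> ennreal (cmod (A (u 1) - A (u 0)))" by (rule ennreal_leI)
  with le show ?thesis unfolding r_def by (rule order_trans[rotated])
qed

theorem caratheodory_le_bergman:
  fixes D :: "(complex^'n) set"
  assumes D: "open D" "bounded D"
  shows "caratheodory_dist D z w \<le> bergman_dist D z w"
  unfolding caratheodory_dist_def bergman_dist_def
proof (intro SUP_least INF_greatest)
  fix F0 \<gamma>
  assume "F0 \<in> {f. f holo_on D \<and> f ` D \<subseteq> ball 0 1 \<and> f z = 0}"
    and "\<gamma> \<in> {\<gamma>. smooth_curve \<gamma> \<and> \<gamma> ` {0..1} \<subseteq> D \<and> \<gamma> 0 = z \<and> \<gamma> 1 = w}"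
  then have F0: "F0 holo_on D" "F0 ` D \<subseteq> ball 0 1" "F0 z = 0"
    and \<gamma>: "smooth_curve \<gamma>" "\<And>t. t \<in> {0..1} \<Longrightarrow> \<gamma> t \<in> D" "\<gamma> 0 = z" "\<gamma> 1 = w"
    by auto
  \<comment> \<open>A rotation making the value at \<open>w\<close> real and nonnegative, as the
    length estimate requires; 1 serves when that value is 0.\<close>
  define c where "c = (if F0 w = 0 then 1 else of_real (cmod (F0 w)) / F0 w)"
  have c: "cmod c = 1" "c * F0 w = of_real (cmod (F0 w))"
    by (auto simp: c_def norm_divide)
  define F where "F = (\<lambda>x. c * F0 x)"
  have F: "F holo_on D"
    unfolding F_def using holo_on_mult(1)[OF holo_on_const F0(1)] .
  have Fb: "F ` D \<subseteq> ball 0 1" using F0(2) c(1) by (auto simp: F_def norm_mult)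
  have Fw: "cmod (F w) = cmod (F0 w)" using c(1) by (simp add: F_def norm_mult)
  have d\<gamma>: "(\<gamma> has_vector_derivative velocity \<gamma> t) (at t within {0..1})" if "t \<in> {0..1}" for t
  proof -
    have "(velocity ^^ 0) \<gamma> differentiable_on {0..1}" using \<gamma>(1) unfolding smooth_curve_def by blast
    then have "\<gamma> differentiable (at t within {0..1})" using that by (simp add: differentiable_on_def)
    then show ?thesis unfolding velocity_def by (rule vector_derivative_works[THEN iffD1])
  qed
  define u' where "u' = (\<lambda>t. frechet_derivative F (at (\<gamma> t)) (velocity \<gamma> t))"
  have "ennreal (artanh (cmod (F (\<gamma> 1)))) \<le>
      (\<integral>\<^sup>+t\<in>{0..1}. ennreal (cmod (u' t) / (1 - (cmod (F (\<gamma> t)))\<^sup>2)) \<partial>lborel)"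
  proof (rule artanh_le_nn_integral)
    fix t :: real assume t: "t \<in> {0..1}"
    have "(F has_derivative frechet_derivative F (at (\<gamma> t))) (at (\<gamma> t))"
      by (rule holo_onD(1)[OF F \<gamma>(2)[OF t]])
    from has_derivative_compose[OF d\<gamma>[OF t, unfolded has_vector_derivative_def] this]
    show "((\<lambda>t. F (\<gamma> t)) has_vector_derivative u' t) (at t within {0..1})"
      unfolding has_vector_derivative_def u'_def
      using linear_scale[OF has_derivative_linear[OF holo_onD(1)[OF F \<gamma>(2)[OF t]]]] by simp
    show "cmod (F (\<gamma> t)) < 1" using Fb \<gamma>(2)[OF t] by auto
  next
    show "F (\<gamma> 0) = 0" by (simp add: F_def \<gamma> F0)
    show "F (\<gamma> 1) = of_real (cmod (F (\<gamma> 1)))" using Fw c(2) by (simp add: \<gamma>) (simp add: F_def)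
  qed
  also have "\<dots> \<le> (\<integral>\<^sup>+t\<in>{0..1}. ennreal (bergman_metric D (\<gamma> t) (velocity \<gamma> t)) \<partial>lborel)"
  proof (rule nn_integral_mono)
    fix t :: real
    show "ennreal (cmod (u' t) / (1 - (cmod (F (\<gamma> t)))\<^sup>2)) * indicator {0..1} t \<le>
        ennreal (bergman_metric D (\<gamma> t) (velocity \<gamma> t)) * indicator {0..1} t"
    \<comment> \<open>Where the derivative vanishes the left-hand side is 0, so the metric bound is
      needed at the other parameters only.\<close>
    proof (cases "t \<in> {0..1} \<and> u' t \<noteq> 0")
      case True
      then show ?thesis
        using bergman_metric_ge[OF D \<gamma>(2) F Fb, of t "velocity \<gamma> t"] unfolding u'_def
        by (simp add: ennreal_leI)
    qed (auto simp: indicator_def)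
  qed
  finally have "ennreal (artanh (cmod (F0 w))) \<le>
      (\<integral>\<^sup>+t\<in>{0..1}. ennreal (bergman_metric D (\<gamma> t) (velocity \<gamma> t)) \<partial>lborel)"
    by (simp add: \<gamma> Fw)
  then have "enn2ereal (ennreal (artanh (cmod (F0 w)))) \<le>
      enn2ereal (\<integral>\<^sup>+t\<in>{0..1}. ennreal (bergman_metric D (\<gamma> t) (velocity \<gamma> t)) \<partial>lborel)"
    by (simp add: less_eq_ennreal.rep_eq)
  \<comment> \<open>\<open>ennreal\<close> truncates negative numbers to 0, which can only increase
    the value.\<close>
  moreover have "ereal (artanh (cmod (F0 w))) \<le> enn2ereal (ennreal (artanh (cmod (F0 w))))"
    by (cases "0 \<le> artanh (cmod (F0 w))")
       (auto simp: enn2ereal_ennreal intro: order_trans[of _ 0])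
  ultimately show "ereal (artanh (cmod (F0 w))) \<le>
      enn2ereal (\<integral>\<^sup>+t\<in>{0..1}. ennreal (bergman_metric D (\<gamma> t) (velocity \<gamma> t)) \<partial>lborel)"
    by (rule order_trans[rotated])
qed

section \<open>The lower bounds\<close>

lemma infdist_frontier_le:
  fixes z z' :: "'a::euclidean_space"
  assumes "z \<in> D" "z' \<notin> D"
  shows "infdist z (frontier D) \<le> dist z z'"
proof -
  have "closed_segment z z' \<inter> frontier D \<noteq> {}"
    by (rule connected_Int_frontier) (use assms in auto)
  then obtain y where y: "y \<in> closed_segment z z'" "y \<in> frontier D" by blast
  then have "infdist z (frontier D) \<le> dist z y" by (intro infdist_le)
  also have "\<dots> \<le> dist z z'" using dist_in_closed_segment[OF y(1)] by (simp add: dist_commute)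
  finally show ?thesis .
qed

lemma bdist_pos:
  assumes "open D" "D \<noteq> UNIV" "z \<in> D"
  shows "0 < bdist D z"
proof -
  have "frontier D \<noteq> {}" using assms(2,3) by (metis empty_iff frontier_eq_empty)
  moreover have "z \<notin> frontier D" using assms(1,3) by (simp add: frontier_def interior_open)
  ultimately have "infdist z (frontier D) \<noteq> 0"
    using in_closed_iff_infdist_zero[OF frontier_closed] by blast
  then show ?thesis unfolding bdist_def using infdist_nonneg[of z "frontier D"] by linarith
qed

text \<open>The distance of a point x from the hyperplane is |l x| / norm a. At \<open>z\<close> it
  is at least \<open>bdist D z\<close>, because the hyperplane misses \<open>D\<close>; at
  \<open>w\<close> it is at most \<open>bdist D w\<close>, because the hyperplane passes through a
  nearest boundary point. In the ratio \<open>norm a\<close> cancels.\<close>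

lemma C_convex_caratheodory_lower_bound:
  fixes D :: "(complex^'n) set"
  assumes D: "open D" "D \<noteq> UNIV" "C_convex D" and zw: "z \<in> D" "w \<in> D"
  shows "ereal (1 / 4 * ln (bdist D z / (4 * bdist D w))) \<le> caratheodory_dist D z w"
proof -
  have fr: "frontier D \<noteq> {}" using D(2) zw by (metis empty_iff frontier_eq_empty)
  obtain p where p: "p \<in> frontier D" "infdist w (frontier D) = dist w p"
    using infdist_attains_inf[OF frontier_closed fr] by metis
  have pD: "p \<notin> D" using p(1) D(1) by (simp add: frontier_def interior_open)
  obtain a where a: "\<And>x. x \<in> D \<Longrightarrow> cdot a (x - p) \<noteq> 0"
    using C_convex_complex_hyperplane[OF D(1,3) _ pD] zw by blast
  have a0: "a \<noteq> 0" using a[OF zw(1)] by (auto simp: cdot_def)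
  define l where "l = (\<lambda>x. cdot a (x - p))"
  have bw: "0 < bdist D w" "bdist D w = norm (w - p)"
    using p(2) pD zw(2) unfolding bdist_def by (auto simp: dist_norm)
  have lw: "cmod (l w) \<le> norm a * bdist D w" unfolding l_def bw(2) by (rule norm_cdot_le)
  have lz: "norm a * bdist D z \<le> cmod (l z)"
  proof -
    define a' where "a' = (\<chi> i. cnj (a $ i))"
    have aa: "cdot a a' = of_real ((norm a)\<^sup>2)"
      by (simp add: cdot_def a'_def norm_vec_def L2_set_def sum_nonneg flip: complex_norm_square)
    have na': "norm a' = norm a" by (simp add: a'_def norm_vec_def)
    have na: "norm a > 0" using a0 by simp
    \<comment> \<open>The orthogonal projection of \<open>z\<close> to the hyperplane; the normal
      direction is the conjugate vector \<open>a'\<close> because \<open>cdot\<close> is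
      bilinear.\<close>
    define z' where "z' = z - (l z / of_real ((norm a)\<^sup>2)) *s a'"
    have "z' - p = (z - p) - (l z / of_real ((norm a)\<^sup>2)) *s a'" by (simp add: z'_def)
    then have "cdot a (z' - p) = l z - l z / of_real ((norm a)\<^sup>2) * of_real ((norm a)\<^sup>2)"
      by (simp only: cdot_diff[of a "z - p"] cdot_smult aa l_def)
    then have "cdot a (z' - p) = 0" using na by simp
    then have "z' \<notin> D" using a by blast
    then have "bdist D z \<le> dist z z'" unfolding bdist_def by (intro infdist_frontier_le zw)
    also have "dist z z' = cmod (l z) / norm a"
      using na by (simp add: z'_def dist_norm norm_smult na' norm_divide norm_mult power2_eq_square)
    finally show ?thesis using na by (simp add: le_divide_eq mult.commute)
  qed
  define G where "G = l ` D"
  have G: "G = (+) (- cdot a p) ` cdot a ` D"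
    unfolding G_def l_def cdot_diff image_image by simp
  have "D \<noteq> {}" using zw by blast
  note proj = C_convex_projection[OF D(1,3) this a0]
  have "open G" unfolding G by (rule open_translation[OF proj(1)])
  moreover have "simply_connected G"
    unfolding G
    by (rule homeomorphic_simply_connected[OF homeomorphic_translation[of "cdot a ` D" "- cdot a p"] proj(2)])
  moreover have "0 \<notin> G" using a by (auto simp: G_def l_def)
  moreover have "l z \<in> G" "l w \<in> G" using zw by (auto simp: G_def)
  ultimately obtain F where F: "F holomorphic_on G" "F ` G \<subseteq> ball 0 1" "F (l z) = 0"
    "1 / 4 * ln (cmod (l z) / cmod (l w)) \<le> artanh (cmod (F (l w)))"
    using simply_connected_artanh_lower_bound by metis
  have "l holo_on D"
    unfolding holo_on_def
  proof (intro ballI exI conjI allI)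
    fix x c X
    have "bounded_linear (cdot a)"
    proof (rule bounded_linear_intro)
      show "cdot a (x + y) = cdot a x + cdot a y" for x y by (rule cdot_add)
      show "cdot a (r *\<^sub>R x) = r *\<^sub>R cdot a x" for r x
        by (simp add: cdot_def scaleR_sum_right)
      show "cmod (cdot a x) \<le> norm x * norm a" for x
        using norm_cdot_le[of a x] by (simp add: mult.commute)
    qed
    from bounded_linear.has_derivative[OF this has_derivative_diff[OF has_derivative_ident has_derivative_const]]
    show "(l has_derivative cdot a) (at x)" unfolding l_def by simp
    show "cdot a (c *s X) = c * cdot a X" by (rule cdot_smult)
  qed
  then have "(\<lambda>x. F (l x)) holo_on D"
    by (rule holo_on_comp_holomorphic(1)[OF _ \<open>open G\<close> F(1)]) (simp add: G_def)
  then have "(\<lambda>x. F (l x)) \<in> {f. f holo_on D \<and> f ` D \<subseteq> ball 0 1 \<and> f z = 0}"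
    using F(2,3) by (auto simp: G_def)
  then have "ereal (artanh (cmod (F (l w)))) \<le> caratheodory_dist D z w"
    unfolding caratheodory_dist_def by (rule SUP_upper)
  moreover have "1 / 4 * ln (bdist D z / (4 * bdist D w)) \<le> 1 / 4 * ln (cmod (l z) / cmod (l w))"
  proof -
    have bz: "0 < bdist D z" by (rule bdist_pos[OF D(1,2) zw(1)])
    have lw0: "0 < cmod (l w)" using a zw(2) by (simp add: l_def)
    \<comment> \<open>The 4 in the claim enters here, by enlarging a positive denominator.\<close>
    have "bdist D z / (4 * bdist D w) \<le> bdist D z / bdist D w"
      using bz bw(1) by (intro divide_left_mono mult_pos_pos) auto
    also have "\<dots> = (norm a * bdist D z) / (norm a * bdist D w)" using a0 by simp
    also have "\<dots> \<le> cmod (l z) / cmod (l w)" using lz lw lw0 bz by (intro frac_le) auto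
    finally show ?thesis using bz bw(1) by (simp add: ln_mono)
  qed
  ultimately show ?thesis using F(4) by (meson ereal_less_eq(3) order_trans)
qed

theorem proposition2:
  fixes D :: "(complex^'n) set"
  assumes "open D" and "connected D" and "D \<noteq> {}" and "D \<noteq> UNIV"
    and "C_convex D"
  shows "(\<forall>z\<in>D. \<forall>w\<in>D.
            ereal (1 / 4 * ln (bdist D z / (4 * bdist D w))) \<le> caratheodory_dist D z w) \<and>
         (bounded D \<longrightarrow>
            (\<forall>K. compact K \<and> K \<subseteq> D \<longrightarrow>
               (\<exists>c>0. \<forall>z\<in>K. \<forall>w\<in>D.
                  ereal (- (1 / 4) * ln (bdist D w) - c) \<le> bergman_dist D z w)))"
proof (intro conjI ballI impI allI)
  show lower: "ereal (1 / 4 * ln (bdist D z / (4 * bdist D w))) \<le> caratheodory_dist D z w"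
    if "z \<in> D" "w \<in> D" for z w
    by (rule C_convex_caratheodory_lower_bound[OF assms(1,4,5) that])
  fix K assume "bounded D" and K: "compact K \<and> K \<subseteq> D"
  have pos: "0 < bdist D z" if "z \<in> D" for z by (rule bdist_pos[OF assms(1,4) that])
  obtain m where m: "0 < m" "\<And>z. z \<in> K \<Longrightarrow> m \<le> bdist D z"
  proof (cases "K = {}")
    case True
    then show thesis using that[of 1] by simp
  next
    case False
    have "continuous_on K (bdist D)" unfolding bdist_def by (intro continuous_intros)
    then obtain x where "x \<in> K" "\<forall>z\<in>K. bdist D x \<le> bdist D z"
      using continuous_attains_inf[of K "bdist D"] K False by blast
    with that[of "bdist D x"] pos K show thesis by blast
  qed
  \<comment> \<open>Since \<open>bdist D z \<ge> m\<close> on \<open>K\<close>, the first bound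
    loses at most 1/4 ln (4 / m); the maximum with 1 makes the constant positive.\<close>
  define c where "c = max 1 (1 / 4 * ln (4 / m))"
  have "ereal (- (1 / 4) * ln (bdist D w) - c) \<le> bergman_dist D z w" if "z \<in> K" "w \<in> D" for z w
  proof -
    have z: "z \<in> D" using that(1) K by blast
    have "ln m \<le> ln (bdist D z)" using m(1) m(2)[OF that(1)] by (simp add: ln_mono)
    moreover have "1 / 4 * ln (4 / m) \<le> c" by (simp add: c_def)
    moreover have "ln (bdist D z / (4 * bdist D w)) = ln (bdist D z) - ln 4 - ln (bdist D w)"
      using pos[OF z] pos[OF that(2)] by (simp add: ln_div ln_mult)
    moreover have "ln (4 / m) = ln 4 - ln m" using m(1) by (simp add: ln_div)
    ultimately have "- (1 / 4) * ln (bdist D w) - c \<le> 1 / 4 * ln (bdist D z / (4 * bdist D w))"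
      by simp
    then have "ereal (- (1 / 4) * ln (bdist D w) - c) \<le> caratheodory_dist D z w"
      using lower[OF z that(2)] by (meson ereal_less_eq(3) order_trans)
    also have "\<dots> \<le> bergman_dist D z w"
      by (rule caratheodory_le_bergman[OF assms(1) \<open>bounded D\<close>])
    finally show ?thesis .
  qed
  moreover have "0 < c" by (simp add: c_def)
  ultimately show "\<exists>c>0. \<forall>z\<in>K. \<forall>w\<in>D.
      ereal (- (1 / 4) * ln (bdist D w) - c) \<le> bergman_dist D z w" by blast
qed

end
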